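(* Let $S$ be the geodesic spray of a Finsler structure $F$ on $M$ with metric tensor $g_{ij}$ (with inverse $g^{ij}$), and suppose that $S$ is also gyroscopic with respect to a Finsler structure $\widetilde F$ (in particular, this includes the case when $S$ is projectively related to $\widetilde F$). Let $\widetilde g_{ij}$ be the metric tensor of $\widetilde F$ and $\widetilde h_{ij}=\widetilde g_{ij}-\frac{\partial\widetilde F}{\partial y^i}\frac{\partial\widetilde F}{\partial y^j}$ its angular metric. Then the $(1,1)$-type tensor $$\mathcal{H}^i_j=\frac{F}{\widetilde F}\,g^{ik}\widetilde h_{kj}=\frac{F}{\widetilde F^3}\,g^{ik}\left(\widetilde g_{kj}\widetilde g_{ls}-\widetilde g_{kl}\widetilde g_{js}\right)y^ly^s$$ is geodesically invariant, that is, $\nabla\mathcal{H}^i_j=0$, where $\nabla$ is the dynamical covariant derivative induced by $S$. Consequently, the scalar functions determined by $\mathcal{H}^i_j$ (traces, eigenvalues, coefficients of the characteristic polynomial) are geodesically invariant, i.e. constant along the integral curves of $S$, and hence provide first integrals for $S$.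
   Context: $M$ is a connected, $n$-dimensional smooth manifold with local coordinates $(x^i)$; $TM$ is its tangent bundle, $T_0M=TM\setminus\{0\}$ is the slit tangent bundle (zero section removed), with induced local coordinates $(x^i,y^i)$. Summation over repeated indices is understood. Homogeneity always means positive homogeneity in the fibre coordinates $y$. Finsler structure: a continuous positive function $F:TM\to\mathbb{R}$ (positive on $T_0M$), smooth on $T_0M$, positively homogeneous of order $1$ in the fibre coordinates, such that the metric tensor $g_{ij}(x,y)=\frac12\frac{\partial^2F^2}{\partial y^i\partial y^j}(x,y)$ is non-degenerate on $T_0M$. Spray: a vector field $S$ on $T_0M$ that is locally of the form $S=y^i\frac{\partial}{\partial x^i}-2G^i(x,y)\frac{\partial}{\partial y^i}$ with $G^i$ smooth locally defined functions on $T_0M$, homogeneous of order $2$ in $y$. Geodesic spray of $F$: the unique spray $S$ satisfying $S\left(\frac{\partial F^2}{\partial y^i}\right)-\frac{\partial F^2}{\partial x^i}=0$ for all $i$. Gyroscopic with respect to $\widetilde F$: there exists a basic $2$-form $\omega\in\Lambda^2(M)$ (a smooth $2$-form on $M$, with skew-symmetric components $\omega_{ij}(x)$ depending only on $x$) such that $S\left(\frac{\partial\widetilde F}{\partial y^i}\right)-\frac{\partial\widetilde F}{\partial x^i}=\omega_{ij}y^j$ for all $i$. Projectively related: $S$ is projectively related to $\widetilde F$ if its geodesics coincide with those of the geodesic spray of $\widetilde F$ up to an orientation preserving reparametrization; equivalently $S\left(\frac{\partial\widetilde F}{\partial y^i}\right)-\frac{\partial\widetilde F}{\partial x^i}=0$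 for all $i$ (the case $\omega=0$). Dynamical covariant derivative induced by $S$: put $N^i_j=\frac{\partial G^i}{\partial y^j}$. On functions $\nabla f=S(f)$; on components of a $(0,2)$-type tensor field on $T_0M$, $\nabla g_{ij}=S(g_{ij})-N^k_i g_{kj}-N^k_j g_{ik}$; extended by the Leibniz rule and compatibility with contractions, so on components of a $(1,1)$-type tensor field $\nabla A^i_j=S(A^i_j)+N^i_kA^k_j-N^k_jA^i_k$. A first integral of $S$ is a function on $T_0M$ that is constant along the integral curves of $S$ (for smooth $f$: $S(f)=0$). *)

theory Defs
  imports "HOL-Analysis.Analysis" "HOL-Computational_Algebra.Polynomial"
begin

section \<open>Smooth maps between Euclidean spaces\<close>

primrec Ck_on :: "nat \<Rightarrow> 'a::euclidean_space set \<Rightarrow> ('a \<Rightarrow> 'b::real_normed_vector) \<Rightarrow> bool" where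
  "Ck_on 0 S f \<longleftrightarrow> continuous_on S f"
| "Ck_on (Suc k) S f \<longleftrightarrow>
     (\<forall>x\<in>S. f differentiable (at x)) \<and> (\<forall>v. Ck_on k S (\<lambda>x. frechet_derivative f (at x) v))"

text \<open>Meant for open \<open>S\<close> only.\<close>
definition smooth_on :: "'a::euclidean_space set \<Rightarrow> ('a \<Rightarrow> 'b::real_normed_vector) \<Rightarrow> bool" where
  "smooth_on S f \<longleftrightarrow> (\<forall>k. Ck_on k S f)"

section \<open>Manifolds\<close>

text \<open>A chart is a pair of its domain and its coordinate map.\<close>
type_synonym ('m, 'e) chart = "'m set \<times> ('m \<Rightarrow> 'e)"

definition chart_inv :: "('m, 'e) chart \<Rightarrow> 'e \<Rightarrow> 'm" where
  "chart_inv c = the_inv_into (fst c) (snd c)"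

definition transition :: "('m, 'e) chart \<Rightarrow> ('m, 'e) chart \<Rightarrow> 'e \<Rightarrow> 'e" where
  "transition c d = snd d \<circ> chart_inv c"

definition smooth_manifold :: "'m topology \<Rightarrow> ('m, 'e::euclidean_space) chart set \<Rightarrow> bool" where
  "smooth_manifold X A \<longleftrightarrow>
     Hausdorff_space X \<and> second_countable X \<and>
     \<Union> (fst ` A) = topspace X \<and>
     (\<forall>c\<in>A. openin X (fst c) \<and> open (snd c ` fst c) \<and>
        homeomorphic_map (subtopology X (fst c)) (top_of_set (snd c ` fst c)) (snd c)) \<and>
     (\<forall>c\<in>A. \<forall>d\<in>A. smooth_on (snd c ` (fst c \<inter> fst d)) (transition c d))"

text \<open>Functions on a manifold given by an atlas \<open>A\<close>; continuity and smoothness are tested in the charts.\<close>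

definition smooth_fun :: "('m, 'e::euclidean_space) chart set \<Rightarrow> ('m \<Rightarrow> 'b::real_normed_vector) \<Rightarrow> bool" where
  "smooth_fun A f \<longleftrightarrow> (\<forall>c\<in>A. smooth_on (snd c ` fst c) (f \<circ> chart_inv c))"

definition continuous_fun :: "('m, 'e::euclidean_space) chart set \<Rightarrow> ('m \<Rightarrow> 'b::real_normed_vector) \<Rightarrow> bool" where
  "continuous_fun A f \<longleftrightarrow> (\<forall>c\<in>A. continuous_on (snd c ` fst c) (f \<circ> chart_inv c))"

section \<open>Tangent bundle and slit tangent bundle\<close>

text \<open>A tangent vector at \<open>p\<close> is represented by \<open>p\<close> together with the family of its components in all
  charts around \<open>p\<close>, related by the Jacobians of the transition maps; the entries for charts not
  containing \<open>p\<close> are normalised to \<open>0\<close>.\<close>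
type_synonym ('m, 'e) tangent = "'m \<times> (('m, 'e) chart \<Rightarrow> 'e)"

definition TM :: "('m, 'e::euclidean_space) chart set \<Rightarrow> ('m, 'e) tangent set" where
  "TM A = {(p, v). p \<in> \<Union> (fst ` A) \<and>
     (\<forall>c. \<not> (c \<in> A \<and> p \<in> fst c) \<longrightarrow> v c = 0) \<and>
     (\<forall>c\<in>A. \<forall>d\<in>A. p \<in> fst c \<inter> fst d \<longrightarrow>
        v d = frechet_derivative (transition c d) (at (snd c p)) (v c))}"

text \<open>The tangent vector at \<open>p\<close> with components \<open>u\<close> in the chart \<open>c\<close>.\<close>
definition tvec :: "('m, 'e::euclidean_space) chart set \<Rightarrow> 'm \<Rightarrow> ('m, 'e) chart \<Rightarrow> 'e \<Rightarrow> ('m, 'e) tangent" where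
  "tvec A p c u = (p, \<lambda>d. if d \<in> A \<and> p \<in> fst d
     then frechet_derivative (transition c d) (at (snd c p)) u else 0)"

definition tscale :: "real \<Rightarrow> ('m, 'e::euclidean_space) tangent \<Rightarrow> ('m, 'e) tangent" where
  "tscale a z = (fst z, \<lambda>c. a *\<^sub>R snd z c)"

definition T0M :: "('m, 'e::euclidean_space) chart set \<Rightarrow> ('m, 'e) tangent set" where
  "T0M A = {z \<in> TM A. \<exists>c\<in>A. snd z c \<noteq> 0}"

definition TM_chart :: "('m, 'e::euclidean_space) chart set \<Rightarrow> ('m, 'e) chart
    \<Rightarrow> (('m, 'e) tangent, 'e \<times> 'e) chart" where
  "TM_chart A c = ({z \<in> TM A. fst z \<in> fst c}, \<lambda>z. (snd c (fst z), snd z c))"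

definition slit_chart :: "('m, 'e::euclidean_space) chart set \<Rightarrow> ('m, 'e) chart
    \<Rightarrow> (('m, 'e) tangent, 'e \<times> 'e) chart" where
  "slit_chart A c = ({z \<in> T0M A. fst z \<in> fst c}, \<lambda>z. (snd c (fst z), snd z c))"

definition slit_atlas :: "('m, 'e::euclidean_space) chart set \<Rightarrow> (('m, 'e) tangent, 'e \<times> 'e) chart set" where
  "slit_atlas A = slit_chart A ` A"

text \<open>The range of the induced coordinates of \<open>T\<^sub>0M\<close> over the chart \<open>c\<close>.\<close>
definition slit_range :: "('m, 'e::euclidean_space) chart \<Rightarrow> ('e \<times> 'e) set" where
  "slit_range c = (snd c ` fst c) \<times> (UNIV - {0})"

section \<open>Vector fields, integral curves, first integrals\<close>

definition vector_field :: "('m, 'e::euclidean_space) chart set \<Rightarrow> ('m \<Rightarrow> ('m, 'e) tangent) \<Rightarrow> bool" where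
  "vector_field B V \<longleftrightarrow>
     (\<forall>z\<in>\<Union> (fst ` B). V z \<in> TM B \<and> fst (V z) = z) \<and>
     (\<forall>c\<in>B. smooth_on (snd c ` fst c) (\<lambda>u. snd (V (chart_inv c u)) c))"

text \<open>The first conjunct for each chart expresses continuity of the curve.\<close>
definition integral_curve :: "('m, 'e::euclidean_space) chart set \<Rightarrow> ('m \<Rightarrow> ('m, 'e) tangent)
    \<Rightarrow> real set \<Rightarrow> (real \<Rightarrow> 'm) \<Rightarrow> bool" where
  "integral_curve B V I \<gamma> \<longleftrightarrow> open I \<and> is_interval I \<and>
     (\<forall>t\<in>I. \<gamma> t \<in> \<Union> (fst ` B) \<and>
        (\<forall>c\<in>B. \<gamma> t \<in> fst c \<longrightarrow>
           (\<forall>\<^sub>F s in at t. \<gamma> s \<in> fst c) \<and>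
           ((snd c \<circ> \<gamma>) has_vector_derivative snd (V (\<gamma> t)) c) (at t)))"

definition first_integral :: "('m, 'e::euclidean_space) chart set \<Rightarrow> ('m \<Rightarrow> ('m, 'e) tangent)
    \<Rightarrow> ('m \<Rightarrow> 'b) \<Rightarrow> bool" where
  "first_integral B V f \<longleftrightarrow> (\<forall>I \<gamma>. integral_curve B V I \<gamma> \<longrightarrow> (f \<circ> \<gamma>) constant_on I)"

section \<open>Calculus in induced coordinates\<close>

definition dx :: "'n::finite \<Rightarrow> ((real^'n) \<times> (real^'n) \<Rightarrow> real) \<Rightarrow> (real^'n) \<times> (real^'n) \<Rightarrow> real" where
  "dx i f z = frechet_derivative f (at z) (axis i 1, 0)"

definition dy :: "'n::finite \<Rightarrow> ((real^'n) \<times> (real^'n) \<Rightarrow> real) \<Rightarrow> (real^'n) \<times> (real^'n) \<Rightarrow> real" where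
  "dy i f z = frechet_derivative f (at z) (0, axis i 1)"

definition loc :: "('m, 'e::euclidean_space) chart set \<Rightarrow> (('m, 'e) tangent \<Rightarrow> 'b) \<Rightarrow> ('m, 'e) chart
    \<Rightarrow> 'e \<times> 'e \<Rightarrow> 'b" where
  "loc A f c = f \<circ> chart_inv (slit_chart A c)"

definition vf_comp :: "('m, 'e::euclidean_space) chart set
    \<Rightarrow> (('m, 'e) tangent \<Rightarrow> (('m, 'e) tangent, 'e \<times> 'e) tangent)
    \<Rightarrow> ('m, 'e) chart \<Rightarrow> 'e \<times> 'e \<Rightarrow> 'e \<times> 'e" where
  "vf_comp A V c z = snd (loc A V c z) (slit_chart A c)"

definition vf_apply :: "('m, 'e::euclidean_space) chart set
    \<Rightarrow> (('m, 'e) tangent \<Rightarrow> (('m, 'e) tangent, 'e \<times> 'e) tangent)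
    \<Rightarrow> ('m, 'e) chart \<Rightarrow> ('e \<times> 'e \<Rightarrow> real) \<Rightarrow> 'e \<times> 'e \<Rightarrow> real" where
  "vf_apply A V c f z = frechet_derivative f (at z) (vf_comp A V c z)"

section \<open>Finsler structures\<close>

definition metric_tensor :: "('m, real^'n::finite) chart set \<Rightarrow> (('m, real^'n) tangent \<Rightarrow> real)
    \<Rightarrow> ('m, real^'n) chart \<Rightarrow> (real^'n) \<times> (real^'n) \<Rightarrow> real^'n^'n" where
  "metric_tensor A F c z = (\<chi> i j. 1/2 * dy i (dy j (\<lambda>w. (loc A F c w)\<^sup>2)) z)"

definition finsler :: "('m, real^'n::finite) chart set \<Rightarrow> (('m, real^'n) tangent \<Rightarrow> real) \<Rightarrow> bool" where
  "finsler A F \<longleftrightarrow>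
     continuous_fun (TM_chart A ` A) F \<and>
     smooth_fun (slit_atlas A) F \<and>
     (\<forall>z\<in>T0M A. F z > 0) \<and>
     (\<forall>z\<in>TM A. \<forall>a>0. F (tscale a z) = a * F z) \<and>
     (\<forall>c\<in>A. \<forall>z\<in>slit_range c. invertible (metric_tensor A F c z))"

definition angular_metric :: "('m, real^'n::finite) chart set \<Rightarrow> (('m, real^'n) tangent \<Rightarrow> real)
    \<Rightarrow> ('m, real^'n) chart \<Rightarrow> (real^'n) \<times> (real^'n) \<Rightarrow> real^'n^'n" where
  "angular_metric A F c z =
     (\<chi> i j. metric_tensor A F c z $ i $ j - dy i (loc A F c) z * dy j (loc A F c) z)"

section \<open>Sprays\<close>

definition spray :: "('m, real^'n::finite) chart set
    \<Rightarrow> (('m, real^'n) tangent \<Rightarrow> (('m, real^'n) tangent, (real^'n) \<times> (real^'n)) tangent) \<Rightarrow> bool" where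
  "spray A S \<longleftrightarrow> vector_field (slit_atlas A) S \<and>
     (\<forall>c\<in>A. \<exists>G. smooth_on (slit_range c) G \<and>
        (\<forall>(x, y)\<in>slit_range c. vf_comp A S c (x, y) = (y, - 2 *\<^sub>R G (x, y))) \<and>
        (\<forall>(x, y)\<in>slit_range c. \<forall>a>0. G (x, a *\<^sub>R y) = a\<^sup>2 *\<^sub>R G (x, y)))"

text \<open>The coefficients \<open>G\<close> read off from \<open>S = y \<partial>\<^sub>x - 2 G \<partial>\<^sub>y\<close>.\<close>
definition spray_coeff :: "('m, real^'n::finite) chart set
    \<Rightarrow> (('m, real^'n) tangent \<Rightarrow> (('m, real^'n) tangent, (real^'n) \<times> (real^'n)) tangent)
    \<Rightarrow> ('m, real^'n) chart \<Rightarrow> (real^'n) \<times> (real^'n) \<Rightarrow> real^'n" where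
  "spray_coeff A S c z = (- 1/2) *\<^sub>R snd (vf_comp A S c z)"

definition nonlin_conn :: "('m, real^'n::finite) chart set
    \<Rightarrow> (('m, real^'n) tangent \<Rightarrow> (('m, real^'n) tangent, (real^'n) \<times> (real^'n)) tangent)
    \<Rightarrow> ('m, real^'n) chart \<Rightarrow> (real^'n) \<times> (real^'n) \<Rightarrow> real^'n^'n" where
  "nonlin_conn A S c z = (\<chi> i j. dy j (\<lambda>w. spray_coeff A S c w $ i) z)"

definition geodesic_spray :: "('m, real^'n::finite) chart set \<Rightarrow> (('m, real^'n) tangent \<Rightarrow> real)
    \<Rightarrow> (('m, real^'n) tangent \<Rightarrow> (('m, real^'n) tangent, (real^'n) \<times> (real^'n)) tangent) \<Rightarrow> bool" where
  "geodesic_spray A F S \<longleftrightarrow> spray A S \<and>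
     (\<forall>c\<in>A. \<forall>z\<in>slit_range c. \<forall>i.
        vf_apply A S c (dy i (\<lambda>w. (loc A F c w)\<^sup>2)) z - dx i (\<lambda>w. (loc A F c w)\<^sup>2) z = 0)"

text \<open>A 2-form takes two tangent vectors over the same point, which is carried by the vectors.\<close>
definition form_comp :: "('m, real^'n::finite) chart set
    \<Rightarrow> (('m, real^'n) tangent \<Rightarrow> ('m, real^'n) tangent \<Rightarrow> real)
    \<Rightarrow> ('m, real^'n) chart \<Rightarrow> 'n \<Rightarrow> 'n \<Rightarrow> real^'n \<Rightarrow> real" where
  "form_comp A \<omega> c i j x =
     \<omega> (tvec A (chart_inv c x) c (axis i 1)) (tvec A (chart_inv c x) c (axis j 1))"

definition two_form :: "('m, real^'n::finite) chart set
    \<Rightarrow> (('m, real^'n) tangent \<Rightarrow> ('m, real^'n) tangent \<Rightarrow> real) \<Rightarrow> bool" where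
  "two_form A \<omega> \<longleftrightarrow> (\<forall>c\<in>A.
     (\<forall>p\<in>fst c. bilinear (\<lambda>u v. \<omega> (tvec A p c u) (tvec A p c v)) \<and>
        (\<forall>u v. \<omega> (tvec A p c u) (tvec A p c v) = - \<omega> (tvec A p c v) (tvec A p c u))) \<and>
     (\<forall>i j. smooth_on (snd c ` fst c) (form_comp A \<omega> c i j)))"

definition gyroscopic :: "('m, real^'n::finite) chart set
    \<Rightarrow> (('m, real^'n) tangent \<Rightarrow> (('m, real^'n) tangent, (real^'n) \<times> (real^'n)) tangent)
    \<Rightarrow> (('m, real^'n) tangent \<Rightarrow> real) \<Rightarrow> bool" where
  "gyroscopic A S F \<longleftrightarrow> (\<exists>\<omega>. two_form A \<omega> \<and>
     (\<forall>c\<in>A. \<forall>(x, y)\<in>slit_range c. \<forall>i.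
        vf_apply A S c (dy i (loc A F c)) (x, y) - dx i (loc A F c) (x, y)
          = (\<Sum>j\<in>UNIV. form_comp A \<omega> c i j x * y $ j)))"

lemma Ck_on_zero: "Ck_on k S (\<lambda>x. 0)"
  by (induction k) (auto simp: frechet_derivative_const)

text \<open>Projective relatedness (vanishing right-hand side) is the case \<open>\<omega> = 0\<close>.\<close>
lemma projectively_related_imp_gyroscopic:
  fixes A :: "('m, real^'n::finite) chart set"
  assumes "\<And>c z i. c \<in> A \<Longrightarrow> z \<in> slit_range c \<Longrightarrow>
    vf_apply A S c (dy i (loc A F c)) z - dx i (loc A F c) z = 0"
  shows "gyroscopic A S F"
proof -
  have f: "form_comp A (\<lambda>_ _. 0) c i j = (\<lambda>_. 0)" for c :: "('m, real^'n) chart" and i j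
    by (simp add: form_comp_def fun_eq_iff)
  have "two_form A (\<lambda>_ _. 0)"
    unfolding two_form_def f smooth_on_def by (simp add: bilinear_def linear_zero Ck_on_zero)
  then show ?thesis
    unfolding gyroscopic_def using assms f by (intro exI[of _ "\<lambda>_ _. 0"]) auto
qed

section \<open>Tensor fields of type (1,1) on the slit tangent bundle\<close>

text \<open>A tensor field is given by its components \<open>T\<^sup>i\<^sub>j = T c (x, y) $ i $ j\<close> in every induced chart; these
  transform with the Jacobian of the change of coordinates on the base manifold.\<close>
definition tensor_field_11 :: "('m, real^'n::finite) chart set
    \<Rightarrow> (('m, real^'n) chart \<Rightarrow> (real^'n) \<times> (real^'n) \<Rightarrow> real^'n^'n) \<Rightarrow> bool" where
  "tensor_field_11 A T \<longleftrightarrow>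
     (\<forall>c\<in>A. smooth_on (slit_range c) (T c)) \<and>
     (\<forall>c\<in>A. \<forall>d\<in>A. \<forall>z\<in>T0M A. fst z \<in> fst c \<inter> fst d \<longrightarrow>
        (let J = matrix (frechet_derivative (transition c d) (at (snd c (fst z))))
         in T d (snd (slit_chart A d) z) ** J = J ** T c (snd (slit_chart A c) z)))"

definition nabla_11 :: "('m, real^'n::finite) chart set
    \<Rightarrow> (('m, real^'n) tangent \<Rightarrow> (('m, real^'n) tangent, (real^'n) \<times> (real^'n)) tangent)
    \<Rightarrow> (('m, real^'n) chart \<Rightarrow> (real^'n) \<times> (real^'n) \<Rightarrow> real^'n^'n)
    \<Rightarrow> ('m, real^'n) chart \<Rightarrow> (real^'n) \<times> (real^'n) \<Rightarrow> real^'n^'n" where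
  "nabla_11 A S T c z = (let N = nonlin_conn A S c z in
     \<chi> i j. vf_apply A S c (\<lambda>w. T c w $ i $ j) z
       + (\<Sum>k\<in>UNIV. N $ i $ k * T c z $ k $ j) - (\<Sum>k\<in>UNIV. N $ k $ j * T c z $ i $ k))"

definition H_tensor :: "('m, real^'n::finite) chart set
    \<Rightarrow> (('m, real^'n) tangent \<Rightarrow> real) \<Rightarrow> (('m, real^'n) tangent \<Rightarrow> real)
    \<Rightarrow> ('m, real^'n) chart \<Rightarrow> (real^'n) \<times> (real^'n) \<Rightarrow> real^'n^'n" where
  "H_tensor A F Ft c z = (\<chi> i j. loc A F c z / loc A Ft c z *
     (\<Sum>k\<in>UNIV. matrix_inv (metric_tensor A F c z) $ i $ k * angular_metric A Ft c z $ k $ j))"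

section \<open>Scalars determined by a (1,1)-tensor field\<close>

primrec matpow :: "real^'n^'n \<Rightarrow> nat \<Rightarrow> real^'n^'n" where
  "matpow M 0 = mat 1"
| "matpow M (Suc k) = M ** matpow M k"

definition charpoly :: "real^'n^'n::finite \<Rightarrow> real poly" where
  "charpoly M = det (\<chi> i j. (if i = j then [:0, 1:] else 0) - [:M $ i $ j:])"

text \<open>The metric may be indefinite, so eigenvalues need not be real.\<close>
definition eigenvalues :: "real^'n^'n::finite \<Rightarrow> complex set" where
  "eigenvalues M = {r. \<exists>v::complex^'n. v \<noteq> 0 \<and> (\<chi> i j. complex_of_real (M $ i $ j)) *v v = r *s v}"

text \<open>The quantity \<open>\<phi>\<close> of the component matrices is the same in all charts, i.e. it is a well-defined
  function on \<open>T\<^sub>0M\<close>, and this function is a first integral.\<close>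
definition scalar_first_integral :: "('m, real^'n::finite) chart set
    \<Rightarrow> (('m, real^'n) tangent \<Rightarrow> (('m, real^'n) tangent, (real^'n) \<times> (real^'n)) tangent)
    \<Rightarrow> (('m, real^'n) chart \<Rightarrow> (real^'n) \<times> (real^'n) \<Rightarrow> real^'n^'n)
    \<Rightarrow> (real^'n^'n \<Rightarrow> 'b) \<Rightarrow> bool" where
  "scalar_first_integral A S T \<phi> \<longleftrightarrow>
     (\<exists>f. (\<forall>c\<in>A. \<forall>z\<in>T0M A. fst z \<in> fst c \<longrightarrow> f z = \<phi> (T c (snd (slit_chart A c) z))) \<and>
       first_integral (slit_atlas A) S f)"

end

theory Submission
  imports Defs
begin

text \<open>
  In an induced chart write \<open>E = F\<^sup>2\<close>, \<open>B\<close> for the Hessian of \<open>Ft\<close> in the fibre coordinates, \<open>g\<close> for the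
  metric tensor of \<open>F\<close> and \<open>N\<close> for the nonlinear connection. Differentiating \<open>Ft\<^sup>2 / 2\<close> twice shows
  that the angular metric is \<open>Ft B\<close>, so the factor \<open>1 / Ft\<close> in the tensor cancels and \<open>H = F g\<^sup>-\<^sup>1 B\<close>. Every factor
  is transported by the spray.

  The reason is a single computation (\<open>hess_lie_derivative\<close>). Suppose a function \<open>f\<close> satisfies
  \<open>S(\<partial>f/\<partial>y\<^sup>i) - \<partial>f/\<partial>x\<^sup>i = \<omega>\<^sub>i\<^sub>j y\<^sup>j\<close>. Differentiating in \<open>y\<^sup>j\<close> and using
  \<open>[\<partial>/\<partial>y\<^sup>j, S] = \<partial>/\<partial>x\<^sup>j - 2 N\<^sup>k\<^sub>j \<partial>/\<partial>y\<^sup>k\<close> produces the mixed terms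
  \<open>\<partial>\<^sup>2f/\<partial>x\<^sup>j\<partial>y\<^sup>i - \<partial>\<^sup>2f/\<partial>x\<^sup>i\<partial>y\<^sup>j\<close> and the form \<open>\<omega>\<^sub>i\<^sub>j\<close>, all of them skew in \<open>i, j\<close>; the symmetric
  part says that the fibre Hessian of \<open>f\<close> has vanishing dynamical covariant derivative. This applies to \<open>E\<close>
  with \<open>\<omega> = 0\<close>, giving \<open>\<nabla>g = 0\<close>, and to \<open>Ft\<close>, giving \<open>\<nabla>B = 0\<close>. Finally \<open>S(F) = 0\<close> is conservation
  of energy (\<open>energy_conserved\<close>), so \<open>\<nabla>H = 0\<close>.

  In matrix form \<open>\<nabla>H = 0\<close> is the Lax equation \<open>S(H) = H N - N H\<close>. The commutator is tangent to the
  similarity class of \<open>H\<close>, so every differentiable similarity invariant is constant along integral curves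
  (\<open>similarity_invariant_lax\<close>, \<open>scalar_first_integral_similarity_invariant\<close>); similarity invariance is also what
  makes such a scalar independent of the chart. Traces of powers and coefficients of the characteristic
  polynomial are of this kind. The eigenvalues are the complex roots of that polynomial, and a continuous
  choice among finitely many constants along a connected curve is constant.
\<close>

section \<open>Smooth functions on open sets\<close>

text \<open>The definition of \<open>Ck_on\<close> inspects derivatives at full neighbourhoods, so openness of the set is essential:
  functions agreeing only on a closed set can have different derivatives there.\<close>

lemma Ck_on_cong:
  assumes "open S" "\<And>x. x \<in> S \<Longrightarrow> f x = g x" "Ck_on k S f"
  shows "Ck_on k S g"
  using assms(2,3)
proof (induction k arbitrary: f g)
  case 0
  then show ?case by (simp cong: continuous_on_cong)
next
  case (Suc k)
  have d: "(g has_derivative frechet_derivative f (at x)) (at x)" if "x \<in> S" for x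
    using Suc.prems that assms(1)
    by (auto intro: has_derivative_transform_within_open simp: frechet_derivative_works)
  have "frechet_derivative g (at x) = frechet_derivative f (at x)" if "x \<in> S" for x
    using d[OF that] frechet_derivative_at by metis
  then have "Ck_on k S (\<lambda>x. frechet_derivative g (at x) v)" for v
    using Suc.prems by (auto intro: Suc.IH[of "\<lambda>x. frechet_derivative f (at x) v"])
  then show ?case using d by (auto simp: differentiable_def)
qed

lemma Ck_on_SucD: "Ck_on (Suc k) S f \<Longrightarrow> Ck_on k S f"
proof (induction k arbitrary: f)
  case 0
  then show ?case
    by (auto intro!: continuous_at_imp_continuous_on differentiable_imp_continuous_within)
next
  case (Suc k)
  have "\<forall>x\<in>S. f differentiable at x" "\<And>v. Ck_on (Suc k) S (\<lambda>x. frechet_derivative f (at x) v)"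
    using Suc.prems Ck_on.simps(2)[of "Suc k" S f] by blast+
  then show ?case using Suc.IH Ck_on.simps(2)[of k S f] by blast
qed

lemma Ck_on_add:
  assumes "open S" "Ck_on k S f" "Ck_on k S g"
  shows "Ck_on k S (\<lambda>x. f x + g x)"
  using assms(2,3)
proof (induction k arbitrary: f g)
  case (Suc k)
  have d: "((\<lambda>x. f x + g x) has_derivative
      (\<lambda>v. frechet_derivative f (at x) v + frechet_derivative g (at x) v)) (at x)" if "x \<in> S" for x
    using Suc.prems that by (intro has_derivative_add) (auto simp: frechet_derivative_works)
  have "Ck_on k S (\<lambda>x. frechet_derivative f (at x) v + frechet_derivative g (at x) v)" for v
    using Suc by auto
  then have "Ck_on k S (\<lambda>x. frechet_derivative (\<lambda>x. f x + g x) (at x) v)" for v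
    by (rule Ck_on_cong[OF assms(1), rotated]) (simp add: frechet_derivative_at[OF d, symmetric])
  then show ?case using d by (auto simp: differentiable_def)
qed (simp add: continuous_on_add)

lemma Ck_on_const: "Ck_on k S (\<lambda>x. c)"
  by (cases k) (auto simp: Ck_on_zero)

lemma Ck_on_sum:
  assumes "open S" "\<And>i. i \<in> I \<Longrightarrow> Ck_on k S (f i)"
  shows "Ck_on k S (\<lambda>x. \<Sum>i\<in>I. f i x)"
  using assms(2)
  by (induction I rule: infinite_finite_induct) (auto simp: Ck_on_const intro: Ck_on_add[OF assms(1)])

text \<open>The derivative of a product is a sum of products of functions that are again \<open>C\<^sup>k\<close>, so one induction
  on \<open>k\<close> settles all the products needed (scalar, scaling of matrices, and matrix multiplication).\<close>

lemma Ck_on_bilinear: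
  assumes "bounded_bilinear p" "open S" "Ck_on k S f" "Ck_on k S g"
  shows "Ck_on k S (\<lambda>x. p (f x) (g x))"
  using assms(3,4)
proof (induction k arbitrary: f g)
  case 0
  then show ?case using bounded_bilinear.continuous_on[OF assms(1)] by auto
next
  case (Suc k)
  have d: "((\<lambda>x. p (f x) (g x)) has_derivative
      (\<lambda>v. p (f x) (frechet_derivative g (at x) v) + p (frechet_derivative f (at x) v) (g x))) (at x)"
    if "x \<in> S" for x
    using Suc.prems that
    by (intro bounded_bilinear.FDERIV[OF assms(1)]) (auto simp: frechet_derivative_works)
  have "Ck_on k S (\<lambda>x. p (f x) (frechet_derivative g (at x) v) + p (frechet_derivative f (at x) v) (g x))" for v
    using Suc.prems Ck_on_SucD[OF Suc.prems(1)] Ck_on_SucD[OF Suc.prems(2)]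
    by (intro Ck_on_add[OF assms(2)] Suc.IH) auto
  then have "Ck_on k S (\<lambda>x. frechet_derivative (\<lambda>x. p (f x) (g x)) (at x) v)" for v
    by (rule Ck_on_cong[OF assms(2), rotated]) (simp add: frechet_derivative_at[OF d, symmetric])
  then show ?case using d by (auto simp: differentiable_def)
qed

lemma Ck_on_bounded_linear:
  assumes "bounded_linear h" "open S" "Ck_on k S f"
  shows "Ck_on k S (\<lambda>x. h (f x))"
  using assms(3)
proof (induction k arbitrary: f)
  case 0
  then show ?case using bounded_linear.continuous_on[OF assms(1)] by auto
next
  case (Suc k)
  have d: "((\<lambda>x. h (f x)) has_derivative (\<lambda>v. h (frechet_derivative f (at x) v))) (at x)"
    if "x \<in> S" for x
    using Suc.prems that
    by (intro bounded_linear.has_derivative[OF assms(1)]) (auto simp: frechet_derivative_works)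
  have "Ck_on k S (\<lambda>x. h (frechet_derivative f (at x) v))" for v
    using Suc by auto
  then have "Ck_on k S (\<lambda>x. frechet_derivative (\<lambda>x. h (f x)) (at x) v)" for v
    by (rule Ck_on_cong[OF assms(2), rotated]) (simp add: frechet_derivative_at[OF d, symmetric])
  then show ?case using d by (auto simp: differentiable_def)
qed

lemma smooth_on_differentiable: "smooth_on S f \<Longrightarrow> x \<in> S \<Longrightarrow> f differentiable at x"
  unfolding smooth_on_def using Ck_on.simps(2)[of 0 S f] by blast

lemma smooth_on_frechet_derivative: "smooth_on S f \<Longrightarrow> smooth_on S (\<lambda>x. frechet_derivative f (at x) v)"
  unfolding smooth_on_def using Ck_on.simps(2)[of _ S f] by blast

lemma smooth_on_continuous: "smooth_on S f \<Longrightarrow> continuous_on S f"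
  unfolding smooth_on_def using Ck_on.simps(1)[of S f] by blast

lemma smooth_on_cong:
  "open S \<Longrightarrow> (\<And>x. x \<in> S \<Longrightarrow> f x = g x) \<Longrightarrow> smooth_on S f \<Longrightarrow> smooth_on S g"
  unfolding smooth_on_def using Ck_on_cong by blast

lemma smooth_on_bilinear:
  "bounded_bilinear p \<Longrightarrow> open S \<Longrightarrow> smooth_on S f \<Longrightarrow> smooth_on S g \<Longrightarrow> smooth_on S (\<lambda>x. p (f x) (g x))"
  by (simp add: smooth_on_def Ck_on_bilinear)

lemma smooth_on_bounded_linear:
  "bounded_linear h \<Longrightarrow> open S \<Longrightarrow> smooth_on S f \<Longrightarrow> smooth_on S (\<lambda>x. h (f x))"
  by (simp add: smooth_on_def Ck_on_bounded_linear)

lemma matrix_basis_expansion: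
  "(\<Sum>i\<in>UNIV. \<Sum>j\<in>UNIV. f i j *\<^sub>R axis i (axis j (1::real))) = (\<chi> i j. f i j :: real^'n::finite^'m::finite)"
proof -
  have "(\<Sum>i\<in>UNIV. \<Sum>j\<in>UNIV. f i j * axis i (axis j (1::real)) $ a $ b) = f a b" for a :: 'm and b :: 'n
  proof -
    have "(\<Sum>i\<in>UNIV. \<Sum>j\<in>UNIV. f i j * axis i (axis j (1::real)) $ a $ b)
        = (\<Sum>i\<in>UNIV. if i = a then (\<Sum>j\<in>UNIV. if j = b then f i j else 0) else 0)"
      by (intro sum.cong refl) (auto simp: axis_def if_distrib[of "(*) _"] cong: if_cong)
    then show ?thesis by simp
  qed
  then show ?thesis by (simp add: vec_eq_iff)
qed

lemma smooth_on_matrix: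
  fixes f :: "'n::finite \<Rightarrow> 'm::finite \<Rightarrow> 'a::euclidean_space \<Rightarrow> real"
  assumes "open S" "\<And>i j. smooth_on S (f i j)"
  shows "smooth_on S (\<lambda>x. \<chi> i j. f i j x)"
proof -
  have "smooth_on S (\<lambda>x. \<Sum>i\<in>UNIV. \<Sum>j\<in>UNIV. f i j x *\<^sub>R axis i (axis j (1::real)))"
    using assms unfolding smooth_on_def
    by (intro allI Ck_on_sum Ck_on_bounded_linear[OF bounded_linear_scaleR_left]) auto
  then show ?thesis
    by (simp add: matrix_basis_expansion)
qed

section \<open>Symmetry of second derivatives\<close>

lemma has_derivative_affine_line:
  assumes "f differentiable at (a + t *\<^sub>R u)"
  shows "((\<lambda>t. f (a + t *\<^sub>R u)) has_real_derivative frechet_derivative f (at (a + t *\<^sub>R u)) u) (at t)"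
proof -
  let ?D = "frechet_derivative f (at (a + t *\<^sub>R u))"
  have D: "(f has_derivative ?D) (at (a + t *\<^sub>R u))"
    using assms frechet_derivative_works by blast
  have "((\<lambda>t. f (a + t *\<^sub>R u)) has_derivative (\<lambda>h. ?D (h *\<^sub>R u))) (at t)"
    by (rule has_derivative_compose[where f = "\<lambda>t. a + t *\<^sub>R u" and g = f, OF _ D])
      (auto intro!: derivative_eq_intros)
  moreover have "?D (h *\<^sub>R u) = h * ?D u" for h
    using linear_frechet_derivative[OF assms] by (simp add: linear_cmul)
  ultimately show ?thesis
    by (simp add: has_field_derivative_def mult.commute[of _ "?D u"])
qed

text \<open>The left-hand side is symmetric in \<open>u\<close> and \<open>v\<close>, whereas the mean value theorem, used first in direction
  \<open>u\<close> and then in direction \<open>v\<close>, evaluates it as one particular mixed derivative at a nearby point.\<close>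

lemma second_difference_mean_value:
  fixes f :: "'a::euclidean_space \<Rightarrow> real"
  assumes f: "smooth_on S f" and "h > 0"
    and S: "\<And>s t. s \<in> {0..h} \<Longrightarrow> t \<in> {0..h} \<Longrightarrow> z + s *\<^sub>R u + t *\<^sub>R v \<in> S"
  shows "\<exists>s\<in>{0..h}. \<exists>t\<in>{0..h}.
    f (z + h *\<^sub>R u + h *\<^sub>R v) - f (z + h *\<^sub>R u) - f (z + h *\<^sub>R v) + f z
      = h * h * frechet_derivative (\<lambda>x. frechet_derivative f (at x) u) (at (z + s *\<^sub>R u + t *\<^sub>R v)) v"
proof -
  define Du where "Du = (\<lambda>x. frechet_derivative f (at x) u)"
  have Du: "smooth_on S Du"
    unfolding Du_def by (rule smooth_on_frechet_derivative[OF f])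
  have line: "((\<lambda>s. f (z + s *\<^sub>R u + t *\<^sub>R v)) has_real_derivative Du (z + s *\<^sub>R u + t *\<^sub>R v)) (at s)"
    if "s \<in> {0..h}" "t \<in> {0..h}" for s t
    using has_derivative_affine_line[of f "z + t *\<^sub>R v" s u]
      smooth_on_differentiable[OF f S[OF that]]
    by (simp add: Du_def algebra_simps)
  have "\<exists>s>0. s < h \<and> (f (z + h *\<^sub>R u + h *\<^sub>R v) - f (z + h *\<^sub>R u + 0 *\<^sub>R v))
      - (f (z + 0 *\<^sub>R u + h *\<^sub>R v) - f (z + 0 *\<^sub>R u + 0 *\<^sub>R v))
      = (h - 0) * (Du (z + s *\<^sub>R u + h *\<^sub>R v) - Du (z + s *\<^sub>R u + 0 *\<^sub>R v))"
    using \<open>h > 0\<close>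
    by (intro MVT2[where f = "\<lambda>s. f (z + s *\<^sub>R u + h *\<^sub>R v) - f (z + s *\<^sub>R u + 0 *\<^sub>R v)"] DERIV_diff line) auto
  then obtain s where s: "0 < s" "s < h" and s_eq:
    "f (z + h *\<^sub>R u + h *\<^sub>R v) - f (z + h *\<^sub>R u) - f (z + h *\<^sub>R v) + f z
      = h * (Du (z + s *\<^sub>R u + h *\<^sub>R v) - Du (z + s *\<^sub>R u))"
    by auto
  have "((\<lambda>t. Du (z + s *\<^sub>R u + t *\<^sub>R v)) has_real_derivative
      frechet_derivative Du (at (z + s *\<^sub>R u + t *\<^sub>R v)) v) (at t)" if "0 \<le> t" "t \<le> h" for t
    using that s by (intro has_derivative_affine_line smooth_on_differentiable[OF Du] S) auto
  from MVT2[OF \<open>h > 0\<close> this] obtain t where t: "0 < t" "t < h"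
    "Du (z + s *\<^sub>R u + h *\<^sub>R v) - Du (z + s *\<^sub>R u)
      = h * frechet_derivative Du (at (z + s *\<^sub>R u + t *\<^sub>R v)) v"
    by auto
  show ?thesis
    using s s_eq t unfolding Du_def[symmetric]
    by (intro bexI[of _ s] bexI[of _ t]) auto
qed

text \<open>Both mixed derivatives are limits of the same symmetric second difference divided by \<open>h\<^sup>2\<close>.\<close>

lemma second_derivative_symmetric:
  fixes f :: "'a::euclidean_space \<Rightarrow> real"
  assumes S: "open S" "z \<in> S" and f: "smooth_on S f"
  shows "frechet_derivative (\<lambda>x. frechet_derivative f (at x) u) (at z) v
    = frechet_derivative (\<lambda>x. frechet_derivative f (at x) v) (at z) u"
proof -
  define P Q where "P = (\<lambda>x. frechet_derivative (\<lambda>x. frechet_derivative f (at x) u) (at x) v)"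
    and "Q = (\<lambda>x. frechet_derivative (\<lambda>x. frechet_derivative f (at x) v) (at x) u)"
  have "continuous_on S P" "continuous_on S Q"
    unfolding P_def Q_def
    by (rule smooth_on_continuous smooth_on_frechet_derivative f)+
  then have cont: "isCont P z" "isCont Q z"
    using S by (auto simp: continuous_on_eq_continuous_at)
  have "\<bar>P z - Q z\<bar> < 2 * e" if e: "e > 0" for e
  proof -
    obtain d1 where d1: "d1 > 0" "\<And>x. dist x z < d1 \<Longrightarrow> \<bar>P x - P z\<bar> < e"
      using cont(1)[unfolded continuous_at_eps_delta dist_real_def, rule_format, OF e] by auto
    obtain d2 where d2: "d2 > 0" "\<And>x. dist x z < d2 \<Longrightarrow> \<bar>Q x - Q z\<bar> < e"
      using cont(2)[unfolded continuous_at_eps_delta dist_real_def, rule_format, OF e] by auto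
    obtain d3 where d3: "d3 > 0" "ball z d3 \<subseteq> S"
      using S open_contains_ball by blast
    define d where "d = Min {d1, d2, d3}"
    have d: "d > 0" "d \<le> d1" "d \<le> d2" "d \<le> d3" using d1 d2 d3 by (auto simp: d_def)
    \<comment> \<open>small enough that the whole parallelogram with sides \<open>h u\<close>, \<open>h v\<close> lies in the ball of radius \<open>d\<close>\<close>
    define h where "h = d / (norm u + norm v + 1)"
    have n: "norm u + norm v + 1 > 0" by (simp add: add_nonneg_pos)
    then have "h > 0" using d by (simp add: h_def)
    have near: "dist (z + s *\<^sub>R u + t *\<^sub>R v) z < d" if "s \<in> {0..h}" "t \<in> {0..h}" for s t
    proof -
      have "norm (s *\<^sub>R u + t *\<^sub>R v) \<le> norm (s *\<^sub>R u) + norm (t *\<^sub>R v)" by (rule norm_triangle_ineq)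
      also have "\<dots> \<le> h * norm u + h * norm v"
        using that by (auto intro!: add_mono mult_right_mono)
      also have "\<dots> < h * (norm u + norm v + 1)" using \<open>h > 0\<close> by (simp add: algebra_simps)
      also have "\<dots> = d" using n by (simp add: h_def)
      finally show ?thesis by (simp add: dist_norm algebra_simps)
    qed
    have inS: "z + s *\<^sub>R u + t *\<^sub>R v \<in> S" if "s \<in> {0..h}" "t \<in> {0..h}" for s t
      using near[OF that] d3 d by (auto simp: subset_iff dist_commute)
    have inS': "z + s *\<^sub>R v + t *\<^sub>R u \<in> S" if "s \<in> {0..h}" "t \<in> {0..h}" for s t
      using inS[OF that(2,1)] by (simp add: algebra_simps)
    obtain s t where st: "s \<in> {0..h}" "t \<in> {0..h}"
      "f (z + h *\<^sub>R u + h *\<^sub>R v) - f (z + h *\<^sub>R u) - f (z + h *\<^sub>R v) + f z = h * h * P (z + s *\<^sub>R u + t *\<^sub>R v)"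
      using second_difference_mean_value[OF f \<open>h > 0\<close> inS] unfolding P_def by blast
    obtain s' t' where st': "s' \<in> {0..h}" "t' \<in> {0..h}"
      "f (z + h *\<^sub>R v + h *\<^sub>R u) - f (z + h *\<^sub>R v) - f (z + h *\<^sub>R u) + f z = h * h * Q (z + s' *\<^sub>R v + t' *\<^sub>R u)"
      using second_difference_mean_value[OF f \<open>h > 0\<close> inS'] unfolding Q_def by blast
    have "h * h * P (z + s *\<^sub>R u + t *\<^sub>R v) = h * h * Q (z + s' *\<^sub>R v + t' *\<^sub>R u)"
      using st(3) st'(3) by (simp add: algebra_simps)
    then have "P (z + s *\<^sub>R u + t *\<^sub>R v) = Q (z + t' *\<^sub>R u + s' *\<^sub>R v)"
      using \<open>h > 0\<close> by (simp add: algebra_simps)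
    moreover have "\<bar>P (z + s *\<^sub>R u + t *\<^sub>R v) - P z\<bar> < e"
      using near[OF st(1,2)] d by (intro d1(2)) auto
    moreover have "\<bar>Q (z + t' *\<^sub>R u + s' *\<^sub>R v) - Q z\<bar> < e"
      using near[OF st'(2,1)] d by (intro d2(2)) auto
    ultimately show ?thesis by linarith
  qed
  from this[of "\<bar>P z - Q z\<bar> / 2"] have "P z = Q z" by (cases "P z = Q z") auto
  then show ?thesis by (simp add: P_def Q_def)
qed

text \<open>This is the commutator \<open>[w, V] = (DV) w\<close> of a constant field \<open>w\<close> with a vector field \<open>V\<close>, written without
  coordinates; it rests on the symmetry of second derivatives.\<close>

lemma has_derivative_along_vector_field:
  fixes f :: "'a::euclidean_space \<Rightarrow> real" and V :: "'a \<Rightarrow> 'a"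
  assumes S: "open S" "z \<in> S" and f: "smooth_on S f" and V: "V differentiable at z"
  shows "((\<lambda>x. frechet_derivative f (at x) (V x)) has_derivative
    (\<lambda>w. frechet_derivative (\<lambda>x. frechet_derivative f (at x) w) (at z) (V z)
      + frechet_derivative f (at z) (frechet_derivative V (at z) w))) (at z)"
proof -
  define D where "D = (\<lambda>u x. frechet_derivative f (at x) u)"
  have lin: "linear (\<lambda>u. D u x)" if "x \<in> S" for x
    unfolding D_def using linear_frechet_derivative smooth_on_differentiable[OF f that] by blast
  have expand: "D u x = (\<Sum>b\<in>Basis. (u \<bullet> b) * D b x)" if "x \<in> S" for u x
  proof -
    have "D u x = D (\<Sum>b\<in>Basis. (u \<bullet> b) *\<^sub>R b) x" by (simp add: euclidean_representation)
    also have "\<dots> = (\<Sum>b\<in>Basis. (u \<bullet> b) * D b x)"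
      by (simp add: linear_sum[OF lin[OF that]] linear_cmul[OF lin[OF that]])
    finally show ?thesis .
  qed
  have Dd: "D b differentiable at x" if "x \<in> S" for b x
    unfolding D_def by (rule smooth_on_differentiable[OF smooth_on_frechet_derivative[OF f] that])
  have "((\<lambda>x. \<Sum>b\<in>Basis. (V x \<bullet> b) * D b x) has_derivative
     (\<lambda>w. \<Sum>b\<in>Basis. (V z \<bullet> b) * frechet_derivative (D b) (at z) w
         + (frechet_derivative V (at z) w \<bullet> b) * D b z)) (at z)"
    using V Dd[OF S(2)]
    by (intro has_derivative_sum has_derivative_mult has_derivative_inner_left)
      (auto simp: frechet_derivative_works)
  then have "((\<lambda>x. D (V x) x) has_derivative
     (\<lambda>w. \<Sum>b\<in>Basis. (V z \<bullet> b) * frechet_derivative (D b) (at z) w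
         + (frechet_derivative V (at z) w \<bullet> b) * D b z)) (at z)"
    using S by (rule has_derivative_transform_within_open) (metis expand)
  moreover have "(\<Sum>b\<in>Basis. (V z \<bullet> b) * frechet_derivative (D b) (at z) w
         + (frechet_derivative V (at z) w \<bullet> b) * D b z)
      = frechet_derivative (D w) (at z) (V z) + D (frechet_derivative V (at z) w) z" for w
  proof -
    have linD: "linear (frechet_derivative (D w) (at z))"
      using linear_frechet_derivative Dd[OF S(2)] by blast
    have "(\<Sum>b\<in>Basis. (V z \<bullet> b) * frechet_derivative (D b) (at z) w)
        = (\<Sum>b\<in>Basis. (V z \<bullet> b) * frechet_derivative (D w) (at z) b)"
      unfolding D_def by (simp add: second_derivative_symmetric[OF S f, of _ w])
    also have "\<dots> = frechet_derivative (D w) (at z) (\<Sum>b\<in>Basis. (V z \<bullet> b) *\<^sub>R b)"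
      by (simp add: linear_sum[OF linD] linear_cmul[OF linD])
    finally show ?thesis
      by (simp add: sum.distrib expand[OF S(2), symmetric] euclidean_representation)
  qed
  ultimately show ?thesis by (simp add: D_def)
qed

section \<open>Differentiating the inverse matrix\<close>

lemma bounded_bilinear_matrix_mult:
  "bounded_bilinear ((**) :: real^'n::finite^'m::finite \<Rightarrow> real^'k::finite^'n \<Rightarrow> real^'k^'m)"
  unfolding bilinear_conv_bounded_bilinear[symmetric] bilinear_def
  by (auto intro!: linearI
      simp: vec_eq_iff matrix_matrix_mult_def sum.distrib sum_distrib_left algebra_simps)

lemma matrix_inv_inverse:
  fixes M :: "real^'n::finite^'n"
  assumes "invertible M"
  shows "M ** matrix_inv M = mat 1" "matrix_inv M ** M = mat 1"
  using assms someI_ex[of "\<lambda>A'. M ** A' = mat 1 \<and> A' ** M = mat 1"]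
  by (auto simp: invertible_def matrix_inv_def)

text \<open>The inverse is an arbitrary choice by definition; Cramer's rule exhibits it as a rational function of the
  entries, which yields its differentiability.\<close>

lemma matrix_inv_cramer:
  fixes M :: "real^'n::finite^'n"
  assumes "invertible M"
  shows "matrix_inv M $ i $ k = det (\<chi> a j. if j = i then axis k 1 $ a else M $ a $ j) / det M"
proof -
  have "M *v (\<chi> a. matrix_inv M $ a $ k) = axis k 1"
  proof -
    have "(M *v (\<chi> a. matrix_inv M $ a $ k)) $ b = (M ** matrix_inv M) $ b $ k" for b
      by (simp add: matrix_vector_mult_def matrix_matrix_mult_def)
    then show ?thesis
      by (simp add: vec_eq_iff matrix_inv_inverse(1)[OF assms] mat_def axis_def)
  qed
  then show ?thesis
    using assms by (subst (asm) cramer) (auto simp: invertible_det_nz vec_eq_iff)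
qed

lemma differentiable_det:
  fixes M :: "'a::real_normed_vector \<Rightarrow> real^'n::finite^'n"
  assumes "\<And>i j. (\<lambda>x. M x $ i $ j) differentiable at x"
  shows "(\<lambda>x. det (M x)) differentiable at x"
proof -
  have "(\<lambda>x. \<Prod>i\<in>I. M x $ i $ p i) differentiable at x" if "finite I" for I and p :: "'n \<Rightarrow> 'n"
    using that assms by (induction I rule: finite_induct) (simp_all add: differentiable_mult)
  then show ?thesis
    unfolding det_def using assms by (intro differentiable_sum differentiable_mult) auto
qed

lemma bounded_linear_matrix_entry: "bounded_linear (\<lambda>M::real^'n::finite^'m::finite. M $ i $ j)"
  by (rule bounded_linear_compose[OF bounded_linear_vec_nth bounded_linear_vec_nth])

lemma open_invertible: "open {M::real^'n::finite^'n. invertible M}"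
proof -
  have "continuous_on UNIV (det :: real^'n^'n \<Rightarrow> real)"
    by (intro continuous_at_imp_continuous_on ballI differentiable_imp_continuous_within
        differentiable_det bounded_linear_imp_differentiable bounded_linear_matrix_entry)
  then have "open {M::real^'n^'n. det M \<noteq> 0}"
    by (intro open_Collect_neq) auto
  then show ?thesis by (simp add: invertible_det_nz)
qed

lemma differentiable_matrix_inv:
  fixes M :: "real^'n::finite^'n"
  assumes "invertible M"
  shows "matrix_inv differentiable at M"
proof -
  have comp: "(\<lambda>M::real^'n^'n. M $ i $ j) differentiable at M" for i j
    by (intro bounded_linear_imp_differentiable bounded_linear_matrix_entry)
  define R where "R M = (\<Sum>i\<in>UNIV. \<Sum>k\<in>UNIV. (det (\<chi> a j. if j = i then axis k 1 $ a else M $ a $ j) / det M)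
      *\<^sub>R axis i (axis k (1::real)))" for M :: "real^'n^'n"
  have entry: "(\<lambda>N. (\<chi> a j. if j = i then axis k 1 $ a else N $ a $ j) $ a $ j) differentiable at M"
    for i k a j
    by (cases "j = i") (simp_all add: comp)
  have "R differentiable at M"
    unfolding R_def using assms
    by (intro differentiable_sum ballI differentiable_scaleR differentiable_divide differentiable_det
        differentiable_const entry comp) (auto simp: invertible_det_nz)
  moreover have "R N = matrix_inv N" if "N \<in> {M. invertible M}" for N
    using that unfolding R_def matrix_basis_expansion
    by (simp add: vec_eq_iff matrix_inv_cramer)
  ultimately show ?thesis
    using open_invertible assms unfolding differentiable_def
    by (metis (no_types, lifting) has_derivative_transform_within_open mem_Collect_eq)
qed

text \<open>Once differentiability is known, the derivative follows by differentiating \<open>M M\<^sup>-\<^sup>1 = 1\<close>.\<close>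

lemma has_derivative_matrix_inv:
  fixes M :: "'a::real_normed_vector \<Rightarrow> real^'n::finite^'n"
  assumes M: "(M has_derivative M') (at x)" and inv: "invertible (M x)"
  shows "((\<lambda>x. matrix_inv (M x)) has_derivative
    (\<lambda>v. - (matrix_inv (M x) ** M' v ** matrix_inv (M x)))) (at x)"
proof -
  let ?I = "\<lambda>x. matrix_inv (M x)"
  have "?I differentiable at x"
    using M differentiable_chain_at[of M x matrix_inv] differentiable_matrix_inv[OF inv]
    by (auto simp: differentiable_def o_def)
  then obtain I' where I': "(?I has_derivative I') (at x)" by (auto simp: differentiable_def)
  obtain U where U: "open U" "x \<in> U" "\<And>y. y \<in> U \<Longrightarrow> invertible (M y)"
    using has_derivative_continuous[OF M] open_invertible inv unfolding continuous_at_open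
    by (metis mem_Collect_eq)
  have "((\<lambda>x. M x ** ?I x) has_derivative (\<lambda>v. M x ** I' v + M' v ** ?I x)) (at x)"
    by (rule bounded_bilinear.FDERIV[OF bounded_bilinear_matrix_mult M I'])
  moreover have "((\<lambda>x. M x ** ?I x) has_derivative (\<lambda>v. 0)) (at x)"
    by (rule has_derivative_transform_within_open[OF has_derivative_const[of "mat 1"] U(1,2)])
      (simp add: matrix_inv_inverse U(3))
  ultimately have "(\<lambda>v. M x ** I' v + M' v ** ?I x) = (\<lambda>v. 0)"
    by (rule has_derivative_unique)
  then have eq: "M x ** I' v = - (M' v ** ?I x)" for v by (metis add_eq_0_iff2)
  have "I' v = - (?I x ** M' v ** ?I x)" for v
  proof -
    have "I' v = (?I x ** M x) ** I' v" by (simp add: matrix_inv_inverse inv)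
    also have "\<dots> = ?I x ** (- (M' v ** ?I x))" by (simp add: eq flip: matrix_mul_assoc)
    finally show ?thesis
      by (simp add: bounded_bilinear.minus_right[OF bounded_bilinear_matrix_mult] matrix_mul_assoc)
  qed
  then show ?thesis using I' by presburger
qed

text \<open>The formula for the derivative expresses it through the inverse itself, so the order of differentiability
  can be raised one step at a time.\<close>

lemma smooth_on_matrix_inv:
  fixes M :: "'a::euclidean_space \<Rightarrow> real^'n::finite^'n"
  assumes S: "open S" and M: "smooth_on S M" and inv: "\<And>x. x \<in> S \<Longrightarrow> invertible (M x)"
  shows "smooth_on S (\<lambda>x. matrix_inv (M x))"
proof -
  have d: "((\<lambda>x. matrix_inv (M x)) has_derivative
      (\<lambda>v. - (matrix_inv (M x) ** frechet_derivative M (at x) v ** matrix_inv (M x)))) (at x)" if "x \<in> S" for x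
    using smooth_on_differentiable[OF M that] inv[OF that]
    by (intro has_derivative_matrix_inv) (auto simp: frechet_derivative_works)
  have "Ck_on k S (\<lambda>x. matrix_inv (M x))" for k
  proof (induction k)
    case 0
    then show ?case using d
      by (auto intro!: continuous_at_imp_continuous_on has_derivative_continuous)
  next
    case (Suc k)
    have "Ck_on k S (\<lambda>x. - (matrix_inv (M x) ** frechet_derivative M (at x) v ** matrix_inv (M x)))" for v
      using smooth_on_frechet_derivative[OF M] Suc.IH
      by (intro Ck_on_bounded_linear[OF bounded_linear_minus[OF bounded_linear_ident] S]
         Ck_on_bilinear[OF bounded_bilinear_matrix_mult S]) (auto simp: smooth_on_def)
    then have "Ck_on k S (\<lambda>x. frechet_derivative (\<lambda>x. matrix_inv (M x)) (at x) v)" for v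
      by (rule Ck_on_cong[OF S, rotated]) (simp add: frechet_derivative_at[OF d, symmetric])
    then show ?case using d by (auto simp: differentiable_def)
  qed
  then show ?thesis by (simp add: smooth_on_def)
qed

section \<open>Fibre Hessians along a spray\<close>

lemma dx_eq: "dx i f = (\<lambda>z. frechet_derivative f (at z) (axis i 1, 0))"
  by (simp add: fun_eq_iff dx_def)

lemma dy_eq: "dy i f = (\<lambda>z. frechet_derivative f (at z) (0, axis i 1))"
  by (simp add: fun_eq_iff dy_def)

lemma smooth_on_dx: "smooth_on W f \<Longrightarrow> smooth_on W (dx i f)"
  unfolding dx_eq by (rule smooth_on_frechet_derivative)

lemma smooth_on_dy: "smooth_on W f \<Longrightarrow> smooth_on W (dy i f)"
  unfolding dy_eq by (rule smooth_on_frechet_derivative)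

lemma dy_cong:
  assumes "open W" "z \<in> W" "\<And>z. z \<in> W \<Longrightarrow> f z = g z"
  shows "dy i f z = dy i g z"
proof -
  have "(f has_derivative f') (at z) \<longleftrightarrow> (g has_derivative f') (at z)" for f'
    using assms has_derivative_transform_within_open[of f f' z UNIV W g]
      has_derivative_transform_within_open[of g f' z UNIV W f] by auto
  then show ?thesis by (simp add: dy_def frechet_derivative_def)
qed

lemma frechet_derivative_coordinates:
  assumes "f differentiable at z"
  shows "frechet_derivative f (at z) (a, b)
    = (\<Sum>k\<in>UNIV. a $ k * dx k f z) + (\<Sum>k\<in>UNIV. b $ k * dy k f z)"
proof -
  let ?D = "frechet_derivative f (at z)"
  note lin = linear_frechet_derivative[OF assms]
  have lin1: "linear (\<lambda>a. ?D (a, 0))" "linear (\<lambda>b. ?D (0, b))"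
    using linear_compose[OF _ lin, of "\<lambda>a. (a, 0)"] linear_compose[OF _ lin, of "\<lambda>b. (0, b)"]
    by (auto simp: o_def linear_iff)
  have "?D (a, b) = ?D (a, 0) + ?D (0, b)"
    using linear_add[OF lin, of "(a, 0)" "(0, b)"] by simp
  also have "?D (a, 0) = ?D (\<Sum>k\<in>UNIV. a $ k *\<^sub>R axis k 1, 0)"
    by (simp add: basis_expansion[of a, unfolded scalar_mult_eq_scaleR])
  also have "\<dots> = (\<Sum>k\<in>UNIV. a $ k * dx k f z)"
    by (simp add: linear_sum[OF lin1(1)] linear_cmul[OF lin1(1)] dx_def)
  also have "?D (0, b) = ?D (0, \<Sum>k\<in>UNIV. b $ k *\<^sub>R axis k 1)"
    by (simp add: basis_expansion[of b, unfolded scalar_mult_eq_scaleR])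
  also have "\<dots> = (\<Sum>k\<in>UNIV. b $ k * dy k f z)"
    by (simp add: linear_sum[OF lin1(2)] linear_cmul[OF lin1(2)] dy_def)
  finally show ?thesis .
qed

lemma sum_axis: "(\<Sum>k\<in>UNIV. axis j (1::real) $ k * c k) = c j" for j :: "'n::finite"
proof -
  have "axis j (1::real) $ k * c k = (if k = j then c k else 0)" for k
    by (simp add: axis_def)
  then show ?thesis by simp
qed

lemma frechet_derivative_matrix_entry:
  fixes M :: "'a::real_normed_vector \<Rightarrow> real^'n::finite^'m::finite"
  assumes "M differentiable at z"
  shows "frechet_derivative (\<lambda>z. M z $ i $ j) (at z) v = frechet_derivative M (at z) v $ i $ j"
proof -
  have "((\<lambda>z. M z $ i $ j) has_derivative (\<lambda>v. frechet_derivative M (at z) v $ i $ j)) (at z)"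
    by (rule bounded_linear.has_derivative[OF bounded_linear_matrix_entry
          assms[unfolded frechet_derivative_works]])
  from frechet_derivative_at[OF this, symmetric] show ?thesis by simp
qed

definition hess :: "((real^'n::finite) \<times> (real^'n) \<Rightarrow> real) \<Rightarrow> (real^'n) \<times> (real^'n) \<Rightarrow> real^'n^'n" where
  "hess f z = (\<chi> i j. dy i (dy j f) z)"

lemma smooth_on_hess:
  assumes "open W" "smooth_on W f"
  shows "smooth_on W (hess f)"
  unfolding hess_def[abs_def] using assms by (intro smooth_on_matrix smooth_on_dy)

lemma dy_commute:
  assumes "open W" "z \<in> W" "smooth_on W f"
  shows "dy i (dy j f) z = dy j (dy i f) z"
  using second_derivative_symmetric[OF assms] by (simp add: dy_eq)

lemma dx_dy_commute:
  assumes "open W" "z \<in> W" "smooth_on W f"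
  shows "dx i (dy j f) z = dy j (dx i f) z"
  using second_derivative_symmetric[OF assms] by (simp add: dy_eq dx_eq)

text \<open>The Euler-Lagrange type equation is differentiated in \<open>y\<^sup>j\<close>. The commutator with \<open>V\<close> contributes
  \<open>\<partial>\<^sup>2f/\<partial>x\<^sup>j\<partial>y\<^sup>i\<close>, the other side \<open>\<partial>\<^sup>2f/\<partial>x\<^sup>i\<partial>y\<^sup>j\<close> and \<open>\<omega>\<^sub>i\<^sub>j\<close>; the difference of
  the mixed derivatives and \<open>\<omega>\<close> are skew and disappear on symmetrization. The skewness of \<open>\<omega>\<close> is exactly
  what makes the Hessian insensitive to the gyroscopic force.\<close>

lemma hess_lie_derivative:
  fixes f :: "(real^'n::finite) \<times> (real^'n) \<Rightarrow> real" and \<omega> :: "'n \<Rightarrow> 'n \<Rightarrow> real^'n \<Rightarrow> real"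
  assumes W: "open W" and f: "smooth_on W f"
    and G: "\<And>z. z \<in> W \<Longrightarrow> G differentiable at z"
    and V: "\<And>z. z \<in> W \<Longrightarrow> V z = (snd z, - 2 *\<^sub>R G z)"
    and EL: "\<And>z i. z \<in> W \<Longrightarrow> frechet_derivative (dy i f) (at z) (V z) - dx i f z
      = (\<Sum>j\<in>UNIV. \<omega> i j (fst z) * snd z $ j)"
    and \<omega>: "\<And>z i j. z \<in> W \<Longrightarrow> \<omega> i j differentiable at (fst z)"
    and skew: "\<And>z i j. z \<in> W \<Longrightarrow> \<omega> i j (fst z) = - \<omega> j i (fst z)"
    and z: "z \<in> W"
  defines "N \<equiv> \<chi> i j. dy j (\<lambda>w. G w $ i) z"
  shows "frechet_derivative (hess f) (at z) (V z) = hess f z ** N + transpose N ** hess f z"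
proof -
  have V': "(V has_derivative (\<lambda>v. (snd v, - 2 *\<^sub>R frechet_derivative G (at z) v))) (at z)"
  proof (rule has_derivative_transform_within_open[OF _ W z])
    show "((\<lambda>z. (snd z, - 2 *\<^sub>R G z)) has_derivative (\<lambda>v. (snd v, - 2 *\<^sub>R frechet_derivative G (at z) v))) (at z)"
      using G[OF z] by (intro derivative_intros) (auto simp: frechet_derivative_works)
  qed (simp add: V)
  have G': "frechet_derivative G (at z) (0, axis j 1) $ k = N $ k $ j" for j k
  proof -
    have "((\<lambda>w. G w $ k) has_derivative (\<lambda>v. frechet_derivative G (at z) v $ k)) (at z)"
      by (rule bounded_linear.has_derivative[OF bounded_linear_vec_nth
            G[OF z, unfolded frechet_derivative_works]])
    from frechet_derivative_at[OF this, symmetric] show ?thesis by (simp add: N_def dy_def)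
  qed
  have main: "frechet_derivative (dy j (dy i f)) (at z) (V z)
      = 2 * (\<Sum>k\<in>UNIV. N $ k $ j * dy k (dy i f) z) + dy j (dx i f) z - dy i (dx j f) z + \<omega> i j (fst z)" for i j
  proof -
    let ?e = "(0, axis j 1) :: (real^'n) \<times> (real^'n)"
    have L: "((\<lambda>z. frechet_derivative (dy i f) (at z) (V z)) has_derivative
       (\<lambda>w. frechet_derivative (\<lambda>x. frechet_derivative (dy i f) (at x) w) (at z) (V z)
        + frechet_derivative (dy i f) (at z) (frechet_derivative V (at z) w))) (at z)"
      using V' by (intro has_derivative_along_vector_field[OF W z smooth_on_dy[OF f]]) (auto simp: differentiable_def)
    have R: "((\<lambda>z. frechet_derivative (dy i f) (at z) (V z)) has_derivative
       (\<lambda>w. frechet_derivative (dx i f) (at z) w + (\<Sum>j\<in>UNIV. \<omega> i j (fst z) * snd w $ j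
          + frechet_derivative (\<omega> i j) (at (fst z)) (fst w) * snd z $ j))) (at z)"
    proof (rule has_derivative_transform_within_open[OF _ W z])
      show "((\<lambda>z. dx i f z + (\<Sum>j\<in>UNIV. \<omega> i j (fst z) * snd z $ j)) has_derivative
         (\<lambda>w. frechet_derivative (dx i f) (at z) w + (\<Sum>j\<in>UNIV. \<omega> i j (fst z) * snd w $ j
          + frechet_derivative (\<omega> i j) (at (fst z)) (fst w) * snd z $ j))) (at z)"
        using \<omega>[OF z] smooth_on_differentiable[OF smooth_on_dx[OF f] z]
        by (intro has_derivative_add has_derivative_sum has_derivative_mult
           has_derivative_compose[of fst fst _ _ "\<omega> i _"]
           bounded_linear.has_derivative[OF bounded_linear_vec_nth] has_derivative_fst has_derivative_snd has_derivative_ident)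
          (auto simp: frechet_derivative_works)
    next
      fix w assume "w \<in> W"
      from EL[OF this, of i]
      show "dx i f w + (\<Sum>j\<in>UNIV. \<omega> i j (fst w) * snd w $ j) = frechet_derivative (dy i f) (at w) (V w)"
        by simp
    qed
    have "frechet_derivative (\<lambda>x. frechet_derivative (dy i f) (at x) ?e) (at z) (V z)
        + frechet_derivative (dy i f) (at z) (frechet_derivative V (at z) ?e)
      = frechet_derivative (dx i f) (at z) ?e + (\<Sum>k\<in>UNIV. \<omega> i k (fst z) * snd ?e $ k
          + frechet_derivative (\<omega> i k) (at (fst z)) (fst ?e) * snd z $ k)"
      by (rule has_derivative_unique[OF L R, THEN fun_cong])
    moreover have "frechet_derivative (\<omega> i k) (at (fst z)) 0 = 0" for k
      using linear_frechet_derivative[OF \<omega>[OF z]] linear_0 by blast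
    moreover have "(\<Sum>k\<in>UNIV. \<omega> i k (fst z) * axis j 1 $ k) = \<omega> i j (fst z)"
      using sum_axis[of j "\<lambda>k. \<omega> i k (fst z)"] by (simp add: mult.commute)
    moreover have "frechet_derivative V (at z) ?e = (axis j 1, - 2 *\<^sub>R frechet_derivative G (at z) ?e)"
      using frechet_derivative_at[OF V', symmetric] by simp
    moreover have "frechet_derivative (dy i f) (at z) (axis j 1, - 2 *\<^sub>R frechet_derivative G (at z) ?e)
        = dx j (dy i f) z - 2 * (\<Sum>k\<in>UNIV. N $ k $ j * dy k (dy i f) z)"
      by (simp add: frechet_derivative_coordinates[OF smooth_on_differentiable[OF smooth_on_dy[OF f] z]]
          G' sum_axis sum_distrib_left sum_negf mult.assoc)
    ultimately show ?thesis
      by (simp add: dx_dy_commute[OF W z f] flip: dy_eq) (simp add: dy_def)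
  qed
  have sym: "dy j (dy i f) w = dy i (dy j f) w" if "w \<in> W" for i j w
    using dy_commute[OF W that f] .
  have symD: "frechet_derivative (dy j (dy i f)) (at z) = frechet_derivative (dy i (dy j f)) (at z)" for i j
    by (rule frechet_derivative_transform_within_open[OF _ W z])
      (use smooth_on_differentiable[OF smooth_on_dy[OF smooth_on_dy[OF f]] z] sym in auto)
  \<comment> \<open>averaging the two instances cancels the skew terms\<close>
  have "frechet_derivative (dy i (dy j f)) (at z) (V z)
      = (\<Sum>k\<in>UNIV. N $ k $ j * dy k (dy i f) z) + (\<Sum>k\<in>UNIV. N $ k $ i * dy k (dy j f) z)" for i j
    using main[where i = i and j = j] main[where i = j and j = i] symD[where i = i and j = j] skew[OF z, of i j] by simp
  moreover have "frechet_derivative (hess f) (at z) (V z) $ i $ j = frechet_derivative (dy i (dy j f)) (at z) (V z)" for i j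
    using frechet_derivative_matrix_entry[OF smooth_on_differentiable[OF smooth_on_hess[OF W f] z], of i j]
    by (simp add: hess_def)
  ultimately show ?thesis
    by (simp add: vec_eq_iff matrix_matrix_mult_def transpose_def hess_def sym[OF z] mult.commute)
qed

text \<open>Euler's identity, obtained by differentiating in \<open>a\<close> at \<open>a = 1\<close>.\<close>

lemma euler_homogeneous:
  fixes f :: "'a::real_normed_vector \<times> 'b::real_normed_vector \<Rightarrow> real"
  assumes f: "f differentiable at (x, y)" and hom: "\<And>a. a > 0 \<Longrightarrow> f (x, a *\<^sub>R y) = a ^ k * f (x, y)"
  shows "frechet_derivative f (at (x, y)) (0, y) = k * f (x, y)"
proof -
  have "((\<lambda>t. f ((x, 0) + t *\<^sub>R (0, y))) has_real_derivative frechet_derivative f (at (x, y)) (0, y)) (at 1)"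
    using has_derivative_affine_line[of f "(x, 0)" 1 "(0, y)"] f by simp
  moreover have "((\<lambda>t. f ((x, 0) + t *\<^sub>R (0, y))) has_real_derivative k * f (x, y)) (at 1)"
  proof (rule has_field_derivative_transform_within_open[where S = "{0<..}"])
    show "((\<lambda>t. t ^ k * f (x, y)) has_real_derivative k * f (x, y)) (at 1)"
      by (auto intro!: derivative_eq_intros)
  qed (auto simp: hom)
  ultimately show ?thesis by (rule DERIV_unique)
qed

text \<open>Euler's identity differentiated once more, in an arbitrary direction \<open>w\<close>.\<close>

lemma euler_homogeneous_lie:
  fixes f :: "(real^'n::finite) \<times> (real^'n) \<Rightarrow> real"
  assumes W: "open W" and f: "smooth_on W f" and z: "z \<in> W"
    and hom: "\<And>z a. z \<in> W \<Longrightarrow> a > 0 \<Longrightarrow> f (fst z, a *\<^sub>R snd z) = a ^ k * f z"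
  shows "frechet_derivative (\<lambda>z. frechet_derivative f (at z) w) (at z) (0, snd z)
    + frechet_derivative f (at z) (0, snd w) = k * frechet_derivative f (at z) w"
proof -
  have V': "((\<lambda>z. (0, snd z)) has_derivative (\<lambda>v. (0, snd v))) (at z)" for z :: "(real^'n) \<times> (real^'n)"
    by (intro derivative_intros)
  have V'': "frechet_derivative (\<lambda>z. (0, snd z)) (at z) = (\<lambda>v. (0, snd v))" for z :: "(real^'n) \<times> (real^'n)"
    using frechet_derivative_at[OF V'] by metis
  have L: "((\<lambda>z. frechet_derivative f (at z) (0, snd z)) has_derivative
       (\<lambda>w. frechet_derivative (\<lambda>x. frechet_derivative f (at x) w) (at z) (0, snd z)
        + frechet_derivative f (at z) (frechet_derivative (\<lambda>z. (0, snd z)) (at z) w))) (at z)"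
    using V'[of z] by (intro has_derivative_along_vector_field[OF W z f]) (auto simp: differentiable_def)
  have R: "((\<lambda>z. frechet_derivative f (at z) (0, snd z)) has_derivative
      (\<lambda>w. k * frechet_derivative f (at z) w)) (at z)"
  proof (rule has_derivative_transform_within_open[OF _ W z])
    show "((\<lambda>z. k * f z) has_derivative (\<lambda>w. k * frechet_derivative f (at z) w)) (at z)"
      using smooth_on_differentiable[OF f z]
      by (intro derivative_intros) (auto simp: frechet_derivative_works)
    show "k * f w = frechet_derivative f (at w) (0, snd w)" if "w \<in> W" for w
      using euler_homogeneous[of f "fst w" "snd w" k] smooth_on_differentiable[OF f that] hom[OF that] by simp
  qed
  show ?thesis
    using has_derivative_unique[OF L R, THEN fun_cong, of w] unfolding V'' .
qed

text \<open>This is Euler's identity for the fibre derivative \<open>\<partial>f/\<partial>y\<^sup>i\<close>, whose degree is one lower. For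
  \<open>k = 1\<close> it says that \<open>y\<close> lies in the kernel of the Hessian.\<close>

lemma euler_hess:
  fixes f :: "(real^'n::finite) \<times> (real^'n) \<Rightarrow> real"
  assumes W: "open W" and f: "smooth_on W f" and z: "z \<in> W"
    and hom: "\<And>z a. z \<in> W \<Longrightarrow> a > 0 \<Longrightarrow> f (fst z, a *\<^sub>R snd z) = a ^ k * f z"
  shows "(\<Sum>l\<in>UNIV. hess f z $ l $ i * snd z $ l) = (real k - 1) * dy i f z"
proof -
  have "(\<Sum>l\<in>UNIV. snd z $ l * dy l (dy i f) z) + dy i f z = k * dy i f z"
    using euler_homogeneous_lie[OF assms, of "(0, axis i 1)"]
    by (simp add: frechet_derivative_coordinates[OF smooth_on_differentiable[OF smooth_on_dy[OF f] z]]
        flip: dy_eq dy_def)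
  then show ?thesis by (simp add: hess_def algebra_simps)
qed

text \<open>Applying the spray to Euler's identity \<open>y\<^sup>i \<partial>f/\<partial>y\<^sup>i = 2 f\<close> gives \<open>S(f)\<close> on the left, by
  the Euler-Lagrange equation, and \<open>2 S(f)\<close> on the right. For a function of degree 1 both sides would be
  \<open>S(f)\<close> and nothing would follow, so the square of the Finsler function has to be used.\<close>

lemma energy_conserved:
  fixes f :: "(real^'n::finite) \<times> (real^'n) \<Rightarrow> real"
  assumes W: "open W" and f: "smooth_on W f" and z: "z \<in> W"
    and hom: "\<And>z a. z \<in> W \<Longrightarrow> a > 0 \<Longrightarrow> f (fst z, a *\<^sub>R snd z) = a\<^sup>2 * f z"
    and V: "V z = (snd z, b)"
    and EL: "\<And>i. frechet_derivative (dy i f) (at z) (V z) = dx i f z"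
  shows "frechet_derivative f (at z) (V z) = 0"
proof -
  note df = smooth_on_differentiable[OF f z]
  have "frechet_derivative (\<lambda>x. frechet_derivative f (at x) (0, snd z)) (at z) (V z)
      = (\<Sum>i\<in>UNIV. snd z $ i * frechet_derivative (dy i f) (at z) (V z))"
  proof -
    have "((\<lambda>x. \<Sum>i\<in>UNIV. snd z $ i * dy i f x) has_derivative
       (\<lambda>v. \<Sum>i\<in>UNIV. snd z $ i * frechet_derivative (dy i f) (at z) v)) (at z)"
      using smooth_on_differentiable[OF smooth_on_dy[OF f] z]
      by (intro derivative_intros) (auto simp: frechet_derivative_works)
    then have "((\<lambda>x. frechet_derivative f (at x) (0, snd z)) has_derivative
       (\<lambda>v. \<Sum>i\<in>UNIV. snd z $ i * frechet_derivative (dy i f) (at z) v)) (at z)"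
      by (rule has_derivative_transform_within_open[OF _ W z])
        (simp add: frechet_derivative_coordinates[OF smooth_on_differentiable[OF f]])
    from frechet_derivative_at[OF this, symmetric] show ?thesis by simp
  qed
  then have "frechet_derivative (\<lambda>x. frechet_derivative f (at x) (V z)) (at z) (0, snd z)
      = (\<Sum>i\<in>UNIV. snd z $ i * dx i f z)"
    using second_derivative_symmetric[OF W z f, of "V z" "(0, snd z)"] by (simp add: EL)
  then show ?thesis
    using euler_homogeneous_lie[OF W f z hom, of "V z"]
    by (simp add: V frechet_derivative_coordinates[OF df])
qed

lemma hess_square:
  assumes W: "open W" and f: "smooth_on W f" and z: "z \<in> W"
  shows "hess (\<lambda>w. (f w)\<^sup>2) z $ i $ j = 2 * (dy i f z * dy j f z + f z * hess f z $ i $ j)"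
proof -
  have d: "(f has_derivative frechet_derivative f (at w)) (at w)" if "w \<in> W" for w
    using smooth_on_differentiable[OF f that] frechet_derivative_works by blast
  have "dy j (\<lambda>w. (f w)\<^sup>2) w = 2 * f w * dy j f w" if "w \<in> W" for w j
  proof -
    have "((\<lambda>w. (f w)\<^sup>2) has_derivative (\<lambda>v. 2 * f w * frechet_derivative f (at w) v)) (at w)"
      using d[OF that] by (auto intro!: derivative_eq_intros)
    from frechet_derivative_at[OF this, symmetric] show ?thesis by (simp add: dy_def)
  qed
  then have "dy i (dy j (\<lambda>w. (f w)\<^sup>2)) z = dy i (\<lambda>w. 2 * f w * dy j f w) z"
    by (rule dy_cong[OF W z])
  also have "\<dots> = 2 * (dy i f z * dy j f z + f z * dy i (dy j f) z)"
  proof -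
    have "((\<lambda>w. 2 * f w * dy j f w) has_derivative
       (\<lambda>v. 2 * (frechet_derivative f (at z) v * dy j f z + f z * frechet_derivative (dy j f) (at z) v))) (at z)"
      using d[OF z] smooth_on_differentiable[OF smooth_on_dy[OF f] z, of j]
      by (auto intro!: derivative_eq_intros simp: frechet_derivative_works algebra_simps)
    from frechet_derivative_at[OF this, symmetric] show ?thesis by (simp add: dy_def)
  qed
  finally show ?thesis by (simp add: hess_def)
qed

text \<open>The left-hand side is the derivative of \<open>g\<^sup>-\<^sup>1 B\<close> when \<open>g\<close> and \<open>B\<close> are transported in the same way;
  the terms in \<open>T\<close>, the transpose of \<open>N\<close>, cancel.\<close>

lemma lax_algebra:
  fixes g gi B N T :: "real^'n::finite^'n"
  assumes "gi ** g = mat 1" "g ** gi = mat 1"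
  shows "- (gi ** (g ** N + T ** g) ** gi) ** B + gi ** (B ** N + T ** B) = gi ** B ** N - N ** (gi ** B)"
proof -
  note bb = bounded_bilinear_matrix_mult
  have "gi ** (g ** N + T ** g) ** gi = (gi ** g) ** N ** gi + gi ** T ** (g ** gi)"
    by (simp add: matrix_add_ldistrib bounded_bilinear.add_left[OF bb] matrix_mul_assoc)
  then show ?thesis
    by (simp add: assms matrix_add_ldistrib bounded_bilinear.add_left[OF bb]
        bounded_bilinear.minus_left[OF bb]
        bounded_bilinear.diff_left[OF bb] matrix_mul_assoc algebra_simps)
qed

section \<open>Induced coordinates on the slit tangent bundle\<close>

abbreviation jac :: "('m, 'e::euclidean_space) chart \<Rightarrow> ('m, 'e) chart \<Rightarrow> 'm \<Rightarrow> 'e \<Rightarrow> 'e" where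
  "jac c d p \<equiv> frechet_derivative (transition c d) (at (snd c p))"

context
  fixes X :: "'m topology" and A :: "('m, 'e::euclidean_space) chart set"
  assumes M: "smooth_manifold X A"
begin

lemma chart_subset: "c \<in> A \<Longrightarrow> fst c \<subseteq> topspace X"
  using M openin_subset unfolding smooth_manifold_def by blast

lemma inj_on_chart: "c \<in> A \<Longrightarrow> inj_on (snd c) (fst c)"
  using M chart_subset[of c] homeomorphic_imp_injective_map[of "subtopology X (fst c)" _ "snd c"]
  unfolding smooth_manifold_def by (auto simp: Int_absorb1)

lemma chart_inv_chart: "c \<in> A \<Longrightarrow> p \<in> fst c \<Longrightarrow> chart_inv c (snd c p) = p"
  unfolding chart_inv_def by (rule the_inv_into_f_f[OF inj_on_chart])

lemma open_chart_range: "c \<in> A \<Longrightarrow> open (snd c ` fst c)"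
  using M unfolding smooth_manifold_def by blast

lemma openin_chart: "c \<in> A \<Longrightarrow> openin X (fst c)"
  using M unfolding smooth_manifold_def by blast

lemma open_chart_image:
  assumes c: "c \<in> A" and U: "openin X U"
  shows "open (snd c ` (fst c \<inter> U))"
proof -
  have "open_map (subtopology X (fst c)) (top_of_set (snd c ` fst c)) (snd c)"
    using M c homeomorphic_imp_open_map unfolding smooth_manifold_def by blast
  moreover have "openin (subtopology X (fst c)) (fst c \<inter> U)"
    using U by (rule openin_subtopology_Int2)
  ultimately have "openin (top_of_set (snd c ` fst c)) (snd c ` (fst c \<inter> U))"
    unfolding open_map_def by blast
  then show ?thesis using open_chart_range[OF c] by (rule openin_open_trans)
qed

lemma transition_chart: "c \<in> A \<Longrightarrow> p \<in> fst c \<Longrightarrow> transition c d (snd c p) = snd d p"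
  by (simp add: transition_def chart_inv_chart)

lemma transition_differentiable:
  assumes "c \<in> A" "d \<in> A" "p \<in> fst c" "p \<in> fst d"
  shows "transition c d differentiable at (snd c p)"
proof (rule smooth_on_differentiable)
  show "smooth_on (snd c ` (fst c \<inter> fst d)) (transition c d)"
    using M assms unfolding smooth_manifold_def by blast
qed (use assms in auto)

lemma linear_jac: "c \<in> A \<Longrightarrow> d \<in> A \<Longrightarrow> p \<in> fst c \<Longrightarrow> p \<in> fst d \<Longrightarrow> linear (jac c d p)"
  by (rule linear_frechet_derivative[OF transition_differentiable])

text \<open>The cocycle condition for the Jacobians of the transition maps, which makes the family of components of
  \<open>tvec\<close> a tangent vector.\<close>

lemma jac_comp:
  assumes A: "c \<in> A" "d \<in> A" "e \<in> A" and p: "p \<in> fst c" "p \<in> fst d" "p \<in> fst e"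
  shows "jac d e p (jac c d p u) = jac c e p u"
proof -
  have tp: "transition c d (snd c p) = snd d p" using A p by (simp add: transition_chart)
  have de: "transition d e differentiable at (transition c d (snd c p))"
    unfolding tp using A p by (intro transition_differentiable)
  have cd: "transition c d differentiable at (snd c p)"
    using A p by (intro transition_differentiable)
  have "frechet_derivative (transition d e \<circ> transition c d) (at (snd c p))
      = frechet_derivative (transition c e) (at (snd c p))"
  proof (rule frechet_derivative_transform_within_open)
    show "transition d e \<circ> transition c d differentiable at (snd c p)"
      by (rule differentiable_chain_at[OF cd de])
    show "open (snd c ` (fst c \<inter> fst d))"
      using A openin_chart by (intro open_chart_image)
    show "snd c p \<in> snd c ` (fst c \<inter> fst d)" using p by blast
    show "(transition d e \<circ> transition c d) x = transition c e x" if "x \<in> snd c ` (fst c \<inter> fst d)" for x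
      using that A by (auto simp: transition_chart)
  qed
  then show ?thesis
    by (simp add: frechet_derivative_compose[OF cd de] tp fun_eq_iff)
qed

lemma jac_self:
  assumes "c \<in> A" "p \<in> fst c"
  shows "jac c c p u = u"
proof -
  have "frechet_derivative (\<lambda>x. x) (at (snd c p)) = jac c c p"
    by (rule frechet_derivative_transform_within_open[OF _ open_chart_range[OF assms(1)]])
      (use assms in \<open>auto simp: transition_chart\<close>)
  then show ?thesis by (metis frechet_derivative_ident)
qed

lemma jac_nonzero:
  assumes "c \<in> A" "d \<in> A" "p \<in> fst c" "p \<in> fst d" "u \<noteq> 0"
  shows "jac c d p u \<noteq> 0"
  using jac_comp[OF assms(1,2,1,3,4,3), of u] jac_self[OF assms(1,3), of u] linear_jac[OF assms(2,1,4,3)] assms(5)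
  by (metis linear_0)

lemma snd_tvec: "d \<in> A \<Longrightarrow> p \<in> fst d \<Longrightarrow> snd (tvec A p c u) d = jac c d p u"
  by (simp add: tvec_def)

lemma fst_tvec [simp]: "fst (tvec A p c u) = p"
  by (simp add: tvec_def)

lemma tvec_in_TM: "c \<in> A \<Longrightarrow> p \<in> fst c \<Longrightarrow> tvec A p c u \<in> TM A"
  by (auto simp: tvec_def TM_def jac_comp)

lemma TM_component_zero:
  assumes "z \<in> TM A" "\<not> (c \<in> A \<and> fst z \<in> fst c)"
  shows "snd z c = 0"
proof (cases z)
  case (Pair p v)
  have "\<forall>d. \<not> (d \<in> A \<and> p \<in> fst d) \<longrightarrow> v d = 0"
    using assms(1) unfolding TM_def Pair mem_Collect_eq case_prod_conv by blast
  then show ?thesis using assms(2) unfolding Pair fst_conv snd_conv by blast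
qed

text \<open>A tangent vector is determined by its components in one chart, so the induced charts are injective.\<close>

lemma TM_eq_tvec:
  assumes "z \<in> TM A" "c \<in> A" "fst z \<in> fst c"
  shows "tvec A (fst z) c (snd z c) = z"
proof (cases z)
  case (Pair p v)
  have v0: "\<forall>d. \<not> (d \<in> A \<and> p \<in> fst d) \<longrightarrow> v d = 0"
    and vd: "\<forall>c\<in>A. \<forall>d\<in>A. p \<in> fst c \<inter> fst d \<longrightarrow> v d = jac c d p (v c)"
    using assms(1) unfolding TM_def Pair mem_Collect_eq case_prod_conv by blast+
  have "(if d \<in> A \<and> p \<in> fst d then jac c d p (v c) else 0) = v d" for d
  proof (cases "d \<in> A \<and> p \<in> fst d")
    case True
    have "p \<in> fst c" using assms(3) by (simp add: Pair)
    with True have "v d = jac c d p (v c)" using vd assms(2) by blast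
    then show ?thesis using True by (simp only: if_True simp_thms)
  next
    case False
    with v0 have "v d = 0" by blast
    then show ?thesis by (simp only: False if_False)
  qed
  then have "(\<lambda>d. if d \<in> A \<and> p \<in> fst d then jac c d p (v c) else 0) = v"
    by (rule ext)
  from arg_cong[where f = "Pair p", OF this] show ?thesis
    unfolding Pair tvec_def fst_conv snd_conv .
qed

lemma tvec_change:
  assumes "c \<in> A" "d \<in> A" "p \<in> fst c" "p \<in> fst d"
  shows "tvec A p c u = tvec A p d (jac c d p u)"
  using assms by (auto simp: tvec_def fun_eq_iff jac_comp)

lemma tvec_in_T0M: "c \<in> A \<Longrightarrow> p \<in> fst c \<Longrightarrow> u \<noteq> 0 \<Longrightarrow> tvec A p c u \<in> T0M A"
  unfolding T0M_def using tvec_in_TM by (auto simp: snd_tvec jac_self intro!: bexI[of _ c])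

lemma T0M_nonzero:
  assumes z: "z \<in> T0M A" and c: "c \<in> A" "fst z \<in> fst c"
  shows "snd z c \<noteq> 0"
proof
  assume 0: "snd z c = 0"
  obtain d where d: "d \<in> A" "snd z d \<noteq> 0" and TM: "z \<in> TM A"
    using z by (auto simp: T0M_def)
  then have p: "fst z \<in> fst d" using TM_component_zero by blast
  have "snd z d = snd (tvec A (fst z) c (snd z c)) d"
    by (simp only: TM_eq_tvec[OF TM c])
  then have "snd z d = jac c d (fst z) 0"
    by (simp only: 0 snd_tvec[OF d(1) p])
  then show False using d linear_0[OF linear_jac[OF c(1) d(1) c(2) p]] by simp
qed

lemma slit_coords: "z \<in> T0M A \<Longrightarrow> c \<in> A \<Longrightarrow> fst z \<in> fst c \<Longrightarrow> snd (slit_chart A c) z \<in> slit_range c"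
  using T0M_nonzero by (auto simp: slit_chart_def slit_range_def)

lemma slit_chart_inv_coords:
  assumes z: "z \<in> T0M A" and c: "c \<in> A" "fst z \<in> fst c"
  shows "chart_inv (slit_chart A c) (snd (slit_chart A c) z) = z"
proof -
  have "inj_on (snd (slit_chart A c)) (fst (slit_chart A c))"
  proof (rule inj_onI)
    fix z w assume z: "z \<in> fst (slit_chart A c)" and w: "w \<in> fst (slit_chart A c)"
      and eq: "snd (slit_chart A c) z = snd (slit_chart A c) w"
    have "fst z = fst w"
      using z w eq inj_onD[OF inj_on_chart[OF c(1)]] by (simp add: slit_chart_def)
    then show "z = w"
      using z w eq TM_eq_tvec[OF _ c(1)] by (simp add: slit_chart_def T0M_def) metis
  qed
  then show ?thesis
    unfolding chart_inv_def using z c by (intro the_inv_into_f_f) (auto simp: slit_chart_def)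
qed

lemma slit_chart_tvec:
  assumes c: "c \<in> A" "p \<in> fst c"
  shows "snd (slit_chart A c) (tvec A p c y) = (snd c p, y)"
  using c by (simp add: slit_chart_def snd_tvec jac_self)

lemma slit_range_coords:
  assumes c: "c \<in> A" and z: "z \<in> slit_range c"
  obtains w where "w \<in> T0M A" "fst w \<in> fst c" "snd (slit_chart A c) w = z"
proof -
  obtain p y where "p \<in> fst c" "y \<noteq> 0" "z = (snd c p, y)" using z by (auto simp: slit_range_def)
  then show ?thesis
    using that[of "tvec A p c y"] c by (simp add: tvec_in_T0M slit_chart_tvec)
qed

lemma slit_chart_image: "c \<in> A \<Longrightarrow> snd (slit_chart A c) ` fst (slit_chart A c) = slit_range c"
proof (intro equalityI subsetI)
  fix z assume c: "c \<in> A"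
  show "z \<in> slit_range c" if "z \<in> snd (slit_chart A c) ` fst (slit_chart A c)"
    using that slit_coords[OF _ c] unfolding slit_chart_def by fastforce
  assume "z \<in> slit_range c"
  with c obtain w where "w \<in> T0M A" "fst w \<in> fst c" "z = snd (slit_chart A c) w"
    using slit_range_coords by metis
  then show "z \<in> snd (slit_chart A c) ` fst (slit_chart A c)"
    by (intro image_eqI[of _ _ w]) (simp_all add: slit_chart_def)
qed

lemma open_slit_range: "c \<in> A \<Longrightarrow> open (slit_range c)"
  unfolding slit_range_def using open_chart_range by (intro open_Times) auto

lemma loc_coords:
  "z \<in> T0M A \<Longrightarrow> c \<in> A \<Longrightarrow> fst z \<in> fst c \<Longrightarrow> loc A f c (snd (slit_chart A c) z) = f z"
  by (simp add: loc_def slit_chart_inv_coords)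

lemma loc_tvec:
  assumes "c \<in> A" "p \<in> fst c" "y \<noteq> 0"
  shows "loc A f c (snd c p, y) = f (tvec A p c y)"
  using loc_coords[OF tvec_in_T0M[OF assms] assms(1), of f] assms by (simp add: slit_chart_tvec)

lemma loc_change:
  assumes "c \<in> A" "d \<in> A" "p \<in> fst c" "p \<in> fst d" "y \<noteq> 0"
  shows "loc A f c (snd c p, y) = loc A f d (snd d p, jac c d p y)"
  using assms jac_nonzero by (simp add: loc_tvec tvec_change[of c d])

lemma loc_homogeneous:
  fixes F :: "('m, 'e) tangent \<Rightarrow> real"
  assumes hom: "\<And>z a. z \<in> TM A \<Longrightarrow> a > 0 \<Longrightarrow> F (tscale a z) = a * F z"
    and c: "c \<in> A" and z: "z \<in> slit_range c" and a: "a > 0"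
  shows "loc A F c (fst z, a *\<^sub>R snd z) = a * loc A F c z"
proof -
  obtain p y where p: "p \<in> fst c" "y \<noteq> 0" "z = (snd c p, y)" using z by (auto simp: slit_range_def)
  have "tscale a (tvec A p c y) = tvec A p c (a *\<^sub>R y)"
    using linear_cmul[OF linear_jac[OF c _ p(1)]] by (auto simp: tscale_def tvec_def fun_eq_iff)
  then show ?thesis
    using hom[OF tvec_in_TM[OF c p(1)] a, of y] p a c by (simp add: loc_tvec)
qed

end

lemma matrix_component: "matrix f $ i $ j = f (axis j 1) $ i"
  by (simp add: matrix_def)

text \<open>For a fixed base point the change of induced coordinates is linear in the fibre. Hence only derivatives
  along lines in the fibre enter, and derivatives of \<open>J\<close> with respect to the base point never occur.\<close>

lemma dy_linear_change:
  fixes f g :: "(real^'n::finite) \<times> (real^'n) \<Rightarrow> real"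
  assumes eq: "\<And>y. y \<noteq> 0 \<Longrightarrow> f (x, y) = g (x', J y)" and J: "linear J" and y: "y \<noteq> 0"
    and f: "f differentiable at (x, y)" and g: "g differentiable at (x', J y)"
  shows "dy i f (x, y) = (\<Sum>a\<in>UNIV. matrix J $ a $ i * dy a g (x', J y))"
proof -
  let ?e = "axis i 1 :: real^'n"
  have "((\<lambda>t. f ((x, y) + t *\<^sub>R (0, ?e))) has_real_derivative frechet_derivative f (at (x, y)) (0, ?e)) (at 0)"
    using has_derivative_affine_line[of f "(x, y)" 0 "(0, ?e)"] f by simp
  moreover have "((\<lambda>t. f ((x, y) + t *\<^sub>R (0, ?e))) has_real_derivative
      frechet_derivative g (at (x', J y)) (0, J ?e)) (at 0)"
  proof (rule has_field_derivative_transform_within_open)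
    show "((\<lambda>t. g ((x', J y) + t *\<^sub>R (0, J ?e))) has_real_derivative
        frechet_derivative g (at (x', J y)) (0, J ?e)) (at 0)"
      using has_derivative_affine_line[of g "(x', J y)" 0 "(0, J ?e)"] g by simp
    have "open ((\<lambda>t. y + t *\<^sub>R ?e) -` (- {0}))"
      by (intro open_vimage continuous_intros)
    then show "open {t. y + t *\<^sub>R ?e \<noteq> 0}" by (simp add: vimage_def)
  qed (use y in \<open>simp_all add: eq linear_add[OF J] linear_cmul[OF J]\<close>)
  ultimately have "dy i f (x, y) = frechet_derivative g (at (x', J y)) (0, J ?e)"
    unfolding dy_def by (rule DERIV_unique)
  then show ?thesis by (simp add: frechet_derivative_coordinates[OF g] matrix_component)
qed

lemma hess_linear_change:
  fixes f g :: "(real^'n::finite) \<times> (real^'n) \<Rightarrow> real"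
  assumes eq: "\<And>y. y \<noteq> 0 \<Longrightarrow> f (x, y) = g (x', J y)" and J: "linear J" "\<And>y. y \<noteq> 0 \<Longrightarrow> J y \<noteq> 0"
    and y: "y \<noteq> 0"
    and f: "smooth_on (U \<times> (UNIV - {0})) f" "x \<in> U" and g: "smooth_on (U' \<times> (UNIV - {0})) g" "x' \<in> U'"
  shows "hess f (x, y) = transpose (matrix J) ** hess g (x', J y) ** matrix J"
proof -
  let ?J = "matrix J"
  have fd: "h differentiable at (x, y)" if "smooth_on (U \<times> (UNIV - {0})) h" "y \<noteq> 0" for h :: "(real^'n) \<times> (real^'n) \<Rightarrow> real" and y
    using smooth_on_differentiable[OF that(1)] that(2) f(2) by simp
  have gd: "h differentiable at (x', J y)" if "smooth_on (U' \<times> (UNIV - {0})) h" "y \<noteq> 0" for h :: "(real^'n) \<times> (real^'n) \<Rightarrow> real" and y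
    using smooth_on_differentiable[OF that(1)] J(2)[OF that(2)] g(2) by simp
  have "dy i (dy j f) (x, y) = (\<Sum>a\<in>UNIV. \<Sum>b\<in>UNIV. ?J $ a $ i * (?J $ b $ j * dy a (dy b g) (x', J y)))" for i j
  proof -
    have first: "dy j f (x, y) = (\<Sum>b\<in>UNIV. ?J $ b $ j * dy b g (x', J y))" if "y \<noteq> 0" for y
      by (rule dy_linear_change[OF eq J(1) that fd[OF f(1) that] gd[OF g(1) that]])
    have gb: "(dy b g has_derivative frechet_derivative (dy b g) (at (x', J y))) (at (x', J y))" for b
      using gd[OF smooth_on_dy[OF g(1)] y] by (simp add: frechet_derivative_works)
    have sum: "((\<lambda>w. \<Sum>b\<in>UNIV. ?J $ b $ j * dy b g w) has_derivative
       (\<lambda>v. \<Sum>b\<in>UNIV. ?J $ b $ j * frechet_derivative (dy b g) (at (x', J y)) v)) (at (x', J y))"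
      using gb by (intro has_derivative_sum has_derivative_mult_right)
    have "dy i (dy j f) (x, y) = (\<Sum>a\<in>UNIV. ?J $ a $ i * dy a (\<lambda>w. \<Sum>b\<in>UNIV. ?J $ b $ j * dy b g w) (x', J y))"
      by (rule dy_linear_change[OF first J(1) y fd[OF smooth_on_dy[OF f(1)] y]])
        (use sum in \<open>auto simp: differentiable_def\<close>)
    moreover have "dy a (\<lambda>w. \<Sum>b\<in>UNIV. ?J $ b $ j * dy b g w) (x', J y)
        = (\<Sum>b\<in>UNIV. ?J $ b $ j * dy a (dy b g) (x', J y))" for a
      using frechet_derivative_at[OF sum, symmetric] by (simp add: dy_def)
    ultimately show ?thesis by (simp add: sum_distrib_left)
  qed
  then show ?thesis
    by (simp add: vec_eq_iff hess_def matrix_matrix_mult_def transpose_def sum_distrib_left sum_distrib_right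
        mult_ac)
      (intro allI, subst sum.swap, simp add: mult_ac)
qed

section \<open>Similarity invariants and the Lax equation\<close>

lemma matrix_inv_unique:
  fixes P :: "real^'n::finite^'n"
  assumes "P ** Q = mat 1"
  shows "matrix_inv P = Q"
proof -
  have "invertible P" using assms invertible_right_inverse by blast
  then have "matrix_inv P ** (P ** Q) = Q"
    by (simp add: matrix_mul_assoc matrix_inv_inverse)
  then show ?thesis by (simp add: assms)
qed

lemma has_derivative_one_minus_scaleR:
  "((\<lambda>h. mat 1 - h *\<^sub>R N) has_derivative (\<lambda>h. - (h *\<^sub>R N))) (at (x::real))" for N :: "real^'n::finite^'n"
  by (auto intro!: derivative_eq_intros)

lemma invertible_near_identity:
  fixes N :: "real^'n::finite^'n"
  obtains U :: "real set" where "open U" "0 \<in> U" "\<And>h. h \<in> U \<Longrightarrow> invertible (mat 1 - h *\<^sub>R N)"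
proof -
  have "continuous (at 0) (\<lambda>h. mat 1 - h *\<^sub>R N)"
    by (rule has_derivative_continuous[OF has_derivative_one_minus_scaleR])
  moreover have "mat 1 - 0 *\<^sub>R N \<in> {M. invertible M}"
    by (auto simp: invertible_def)
  ultimately show ?thesis
    using that open_invertible unfolding continuous_at_open by (metis mem_Collect_eq)
qed

text \<open>The commutator is the velocity at \<open>h = 0\<close> of the curve \<open>(1 - h N) M (1 - h N)\<^sup>-\<^sup>1\<close>, on which
  \<open>\<phi>\<close> is constant.\<close>

lemma similarity_invariant_lax:
  fixes \<phi> :: "real^'n::finite^'n \<Rightarrow> real"
  assumes \<phi>: "(\<phi> has_derivative \<phi>') (at M)"
    and inv: "\<And>P M'. invertible P \<Longrightarrow> M' ** P = P ** M \<Longrightarrow> \<phi> M' = \<phi> M"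
  shows "\<phi>' (M ** N - N ** M) = 0"
proof -
  note bb = bounded_bilinear_matrix_mult
  define P where "P = (\<lambda>h::real. mat 1 - h *\<^sub>R N)"
  define C where "C = (\<lambda>h. P h ** M ** matrix_inv (P h))"
  have P0: "P 0 = mat 1" "matrix_inv (mat 1) = (mat 1 :: real^'n^'n)" and inv0: "invertible (P 0)"
    by (auto simp: P_def matrix_inv_unique invertible_def)
  have P': "(P has_derivative (\<lambda>h. - (h *\<^sub>R N))) (at 0)"
    unfolding P_def by (rule has_derivative_one_minus_scaleR)
  have I': "((\<lambda>h. matrix_inv (P h)) has_derivative (\<lambda>h. h *\<^sub>R N)) (at 0)"
    using has_derivative_matrix_inv[OF P' inv0]
    by (simp add: P0 bounded_bilinear.minus_left[OF bb] bounded_bilinear.minus_right[OF bb])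
  have "(C has_derivative (\<lambda>h. P 0 ** M ** (h *\<^sub>R N) + (P 0 ** 0 + (- (h *\<^sub>R N)) ** M) ** matrix_inv (P 0))) (at 0)"
    unfolding C_def
    by (rule bounded_bilinear.FDERIV[OF bb bounded_bilinear.FDERIV[OF bb P' has_derivative_const] I'])
  then have "(C has_derivative (\<lambda>h. h *\<^sub>R (M ** N - N ** M))) (at 0)"
    by (simp add: P0 bounded_bilinear.minus_left[OF bb] bounded_bilinear.zero_right[OF bb]
        bounded_bilinear.scaleR_left[OF bb] bounded_bilinear.scaleR_right[OF bb] algebra_simps)
  moreover have "C 0 = M" by (simp add: C_def P0)
  ultimately have "((\<lambda>h. \<phi> (C h)) has_derivative (\<lambda>h. \<phi>' (h *\<^sub>R (M ** N - N ** M)))) (at 0)"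
    using \<phi> by (intro has_derivative_compose[where g = \<phi> and f = C]) auto
  moreover obtain U where U: "open U" "0 \<in> U" "\<And>h. h \<in> U \<Longrightarrow> invertible (P h)"
    using invertible_near_identity[of N] unfolding P_def by metis
  have "((\<lambda>h. \<phi> (C h)) has_derivative (\<lambda>h. 0)) (at 0)"
  proof (rule has_derivative_transform_within_open[OF has_derivative_const[of "\<phi> M"] U(1,2)])
    fix h assume "h \<in> U"
    then have h: "invertible (P h)" by (rule U)
    then have "C h ** P h = P h ** M"
      by (simp add: C_def matrix_inv_inverse flip: matrix_mul_assoc)
    with inv[OF h] show "\<phi> M = \<phi> (C h)" by simp
  qed
  ultimately have "(\<lambda>h. \<phi>' (h *\<^sub>R (M ** N - N ** M))) = (\<lambda>h. 0)"
    by (rule has_derivative_unique)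
  from fun_cong[OF this, of 1] show ?thesis by simp
qed

lemma poly_det: "poly (det M) x = det (\<chi> i j. poly (M $ i $ j) x)" for M :: "'a::comm_ring_1 poly^'n::finite^'n"
  by (simp add: det_def poly_sum poly_prod)

lemma poly_charpoly: "poly (charpoly M) x = det (x *\<^sub>R mat 1 - M)" for M :: "real^'n::finite^'n"
proof -
  have "poly (charpoly M) x = det (\<chi> i j. poly ((if i = j then [:0, 1:] else 0) - [:M $ i $ j:]) x)"
    unfolding charpoly_def poly_det by simp
  also have "(\<chi> i j. poly ((if i = j then [:0, 1:] else 0) - [:M $ i $ j:]) x) = x *\<^sub>R mat 1 - M"
    by (simp add: vec_eq_iff mat_def)
  finally show ?thesis .
qed

lemma charpoly_similar:
  fixes M M' P :: "real^'n::finite^'n"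
  assumes P: "invertible P" and eq: "M' ** P = P ** M"
  shows "charpoly M' = charpoly M"
proof -
  note bb = bounded_bilinear_matrix_mult
  have "poly (charpoly M') x = poly (charpoly M) x" for x
  proof -
    have "(x *\<^sub>R mat 1 - M') ** P = P ** (x *\<^sub>R mat 1 - M)"
      by (simp add: bounded_bilinear.diff_left[OF bb] bounded_bilinear.diff_right[OF bb]
          bounded_bilinear.scaleR_left[OF bb] bounded_bilinear.scaleR_right[OF bb] eq)
    then have "det (x *\<^sub>R mat 1 - M') * det P = det P * det (x *\<^sub>R mat 1 - M)"
      by (metis det_mul)
    then show ?thesis using P by (simp add: poly_charpoly invertible_det_nz)
  qed
  then show ?thesis by (simp add: poly_eq_poly_eq_iff[symmetric] fun_eq_iff)
qed

text \<open>Were it zero, every \<open>x 1 - M\<close> would be singular, contrary to the invertibility of \<open>1 - h M\<close> for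
  small \<open>h\<close>, where \<open>x = 1 / h\<close>.\<close>

lemma charpoly_nonzero: "charpoly M \<noteq> 0" for M :: "real^'n::finite^'n"
proof
  assume 0: "charpoly M = 0"
  obtain U where U: "open U" "0 \<in> U" "\<And>h. h \<in> U \<Longrightarrow> invertible (mat 1 - h *\<^sub>R M)"
    using invertible_near_identity[of M] by metis
  then obtain e where "e > 0" "ball 0 e \<subseteq> U" using open_contains_ball by metis
  then have h: "invertible (mat 1 - (e/2) *\<^sub>R M)" using U(3)[of "e/2"] by (auto simp: subset_iff)
  have "mat 1 - (e/2) *\<^sub>R M = (e/2) *\<^sub>R ((2/e) *\<^sub>R mat 1 - M)"
    using \<open>e > 0\<close> by (simp add: scaleR_diff_right)
  moreover have "\<not> invertible ((2/e) *\<^sub>R mat 1 - M)"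
    using 0 poly_charpoly[of M "2/e"] by (simp add: invertible_det_nz)
  moreover have "invertible ((2/e) *\<^sub>R mat 1 - M)" if "invertible ((e/2) *\<^sub>R ((2/e) *\<^sub>R mat 1 - M))"
    using that \<open>e > 0\<close> unfolding invertible_right_inverse
    by (metis bounded_bilinear.scaleR_left[OF bounded_bilinear_matrix_mult] bounded_bilinear.scaleR_right[OF bounded_bilinear_matrix_mult])
  ultimately show False using h by metis
qed

lemma poly_map_of_real_mult:
  "map_poly complex_of_real (p * q) = map_poly complex_of_real p * map_poly complex_of_real q"
  by (rule poly_eqI) (simp add: coeff_map_poly coeff_mult)

lemma poly_map_of_real_add:
  "map_poly complex_of_real (p + q) = map_poly complex_of_real p + map_poly complex_of_real q"
  by (rule poly_eqI) (simp add: coeff_map_poly)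

lemma poly_map_of_real_sum:
  "map_poly complex_of_real (sum f I) = (\<Sum>i\<in>I. map_poly complex_of_real (f i))"
  by (induction I rule: infinite_finite_induct) (simp_all add: poly_map_of_real_add)

lemma poly_map_of_real_prod:
  "map_poly complex_of_real (prod f I) = (\<Prod>i\<in>I. map_poly complex_of_real (f i))"
  by (induction I rule: infinite_finite_induct) (simp_all add: poly_map_of_real_mult map_poly_1)

lemma poly_map_of_real_of_int: "map_poly complex_of_real (of_int k) = of_int k"
  by (simp add: of_int_poly map_poly_pCons)

lemma map_poly_det:
  "map_poly complex_of_real (det M) = det (\<chi> i j. map_poly complex_of_real (M $ i $ j))"
  for M :: "real poly^'n::finite^'n"
  by (simp add: det_def poly_map_of_real_sum poly_map_of_real_mult poly_map_of_real_prod poly_map_of_real_of_int)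

lemma eigenvalues_charpoly:
  "eigenvalues M = {r. poly (map_poly complex_of_real (charpoly M)) r = 0}" for M :: "real^'n::finite^'n"
proof -
  let ?M = "(\<chi> i j. complex_of_real (M $ i $ j)) :: complex^'n^'n"
  have "poly (map_poly complex_of_real (charpoly M)) r = det (mat r - ?M)" for r
  proof -
    have "poly (map_poly complex_of_real (charpoly M)) r
      = det (\<chi> i j. poly (map_poly complex_of_real ((if i = j then [:0, 1:] else 0) - [:M $ i $ j:])) r)"
      unfolding charpoly_def map_poly_det poly_det by simp
    also have "(\<chi> i j. poly (map_poly complex_of_real ((if i = j then [:0, 1:] else 0) - [:M $ i $ j:])) r) = mat r - ?M"
      by (simp add: vec_eq_iff mat_def map_poly_pCons)
    finally show ?thesis .
  qed
  moreover have "det (mat r - ?M) = 0 \<longleftrightarrow> (\<exists>v. v \<noteq> 0 \<and> ?M *v v = r *s v)" for r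
  proof -
    have "(mat r - ?M) *v v = r *s v - ?M *v v" for v
    proof -
      have "mat r *v v = r *s v"
        by (simp add: vec_eq_iff matrix_vector_mult_def mat_def if_distrib[of "\<lambda>a. a * _"] cong: if_cong)
      then show ?thesis by (simp add: matrix_vector_mult_diff_rdistrib)
    qed
    moreover have "det (mat r - ?M) = 0 \<longleftrightarrow> (\<exists>v. v \<noteq> 0 \<and> (mat r - ?M) *v v = 0)"
      using invertible_det_nz[of "mat r - ?M"] unfolding invertible_left_inverse matrix_left_invertible_ker by blast
    ultimately show ?thesis by (metis eq_iff_diff_eq_0)
  qed
  ultimately show ?thesis by (simp add: eigenvalues_def)
qed

lemma finite_eigenvalues: "finite (eigenvalues M)" for M :: "real^'n::finite^'n"
proof -
  have "map_poly complex_of_real (charpoly M) \<noteq> 0"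
    using charpoly_nonzero[of M] by (simp add: map_poly_eq_0_iff)
  then show ?thesis unfolding eigenvalues_charpoly by (rule poly_roots_finite)
qed

text \<open>The property that all coefficients depend differentiably on the matrix is inherited by sums and products
  of polynomials, hence by determinants.\<close>

lemma differentiable_coeff_charpoly:
  "(\<lambda>M. coeff (charpoly M) k) differentiable at M" for M :: "real^'n::finite^'n"
proof -
  define D where "D = (\<lambda>p :: real^'n^'n \<Rightarrow> real poly. \<forall>k. (\<lambda>M. coeff (p M) k) differentiable at M)"
  have D_const: "D (\<lambda>M. p)" for p by (simp add: D_def)
  have D_add: "D p \<Longrightarrow> D q \<Longrightarrow> D (\<lambda>M. p M + q M)" for p q by (simp add: D_def)
  have D_mult: "D p \<Longrightarrow> D q \<Longrightarrow> D (\<lambda>M. p M * q M)" for p q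
    by (simp add: D_def coeff_mult)
  have D_sum: "(\<And>i. i \<in> I \<Longrightarrow> D (f i)) \<Longrightarrow> D (\<lambda>M. \<Sum>i\<in>I. f i M)" for I :: "('n \<Rightarrow> 'n) set" and f
    by (induction I rule: infinite_finite_induct) (auto simp: D_const D_add)
  have D_prod: "(\<And>i. i \<in> I \<Longrightarrow> D (f i)) \<Longrightarrow> D (\<lambda>M. \<Prod>i\<in>I. f i M)" for I :: "'n set" and f
    by (induction I rule: infinite_finite_induct) (auto simp: D_const D_mult)
  have D_entry: "D (\<lambda>M. (if i = j then [:0, 1:] else 0) - [:M $ i $ j:])" for i j
  proof -
    have "(\<lambda>M. coeff [:M $ i $ j:] k) differentiable at M" for k
      using bounded_linear_imp_differentiable[OF bounded_linear_matrix_entry, of i j "at M"]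
      by (cases k) simp_all
    then show ?thesis by (simp add: D_def)
  qed
  have "D charpoly"
    unfolding charpoly_def[abs_def] det_def vec_lambda_beta
    by (intro D_sum D_mult D_prod D_const D_entry)
  then show ?thesis by (simp add: D_def)
qed

lemma matpow_similar:
  "M' ** P = P ** M \<Longrightarrow> matpow M' k ** P = P ** matpow M k"
  by (induction k) (simp_all, metis matrix_mul_assoc)

lemma trace_matpow_similar:
  fixes M M' P :: "real^'n::finite^'n"
  assumes P: "invertible P" and eq: "M' ** P = P ** M"
  shows "trace (matpow M' k) = trace (matpow M k)"
proof -
  have "trace (matpow M' k) = trace ((matpow M' k ** P) ** matrix_inv P)"
    by (simp add: matrix_inv_inverse P flip: matrix_mul_assoc)
  also have "\<dots> = trace (matrix_inv P ** (P ** matpow M k))"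
    unfolding matpow_similar[OF eq] by (rule trace_mul_sym)
  finally show ?thesis by (simp add: matrix_mul_assoc matrix_inv_inverse P)
qed

lemma differentiable_trace_matpow:
  "(\<lambda>M. trace (matpow M k)) differentiable at M" for M :: "real^'n::finite^'n"
proof -
  have pow: "(\<lambda>M. matpow M k) differentiable at M"
  proof (induction k)
    case (Suc k)
    then obtain D where "((\<lambda>M. matpow M k) has_derivative D) (at M)" by (auto simp: differentiable_def)
    from bounded_bilinear.FDERIV[OF bounded_bilinear_matrix_mult has_derivative_ident this]
    show ?case by (auto simp: differentiable_def)
  qed simp
  then obtain D where D: "((\<lambda>M. matpow M k) has_derivative D) (at M)" by (auto simp: differentiable_def)
  have "((\<lambda>M. trace (matpow M k)) has_derivative (\<lambda>v. \<Sum>i\<in>UNIV. D v $ i $ i)) (at M)"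
    unfolding trace_def
    by (intro has_derivative_sum bounded_linear.has_derivative[OF bounded_linear_matrix_entry D])
  then show ?thesis by (auto simp: differentiable_def)
qed

section \<open>First integrals from parallel tensor fields\<close>

lemma integral_curve_slit_chart:
  assumes \<gamma>: "integral_curve (slit_atlas A) S I \<gamma>" and t: "t \<in> I"
  obtains c where "c \<in> A" "\<gamma> t \<in> T0M A" "fst (\<gamma> t) \<in> fst c"
    "\<forall>\<^sub>F s in at t. \<gamma> s \<in> T0M A \<and> fst (\<gamma> s) \<in> fst c"
    "((\<lambda>s. snd (slit_chart A c) (\<gamma> s)) has_vector_derivative snd (S (\<gamma> t)) (slit_chart A c)) (at t)"
proof -
  have ex: "\<gamma> t \<in> \<Union> (fst ` slit_atlas A)"
    and all: "\<forall>c\<in>slit_atlas A. \<gamma> t \<in> fst c \<longrightarrow>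
           (\<forall>\<^sub>F s in at t. \<gamma> s \<in> fst c) \<and>
           ((snd c \<circ> \<gamma>) has_vector_derivative snd (S (\<gamma> t)) c) (at t)"
    using \<gamma> t unfolding integral_curve_def by blast+
  obtain c where c: "c \<in> A" "\<gamma> t \<in> fst (slit_chart A c)"
    using ex by (auto simp: slit_atlas_def)
  have dom: "w \<in> fst (slit_chart A c) \<longleftrightarrow> w \<in> T0M A \<and> fst w \<in> fst c" for w
    by (simp add: slit_chart_def)
  have "slit_chart A c \<in> slit_atlas A" using c by (simp add: slit_atlas_def)
  with all c(2) have "\<forall>\<^sub>F s in at t. \<gamma> s \<in> fst (slit_chart A c)"
    and "((snd (slit_chart A c) \<circ> \<gamma>) has_vector_derivative snd (S (\<gamma> t)) (slit_chart A c)) (at t)"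
    by blast+
  with c show ?thesis by (intro that[of c]) (simp_all add: dom o_def)
qed

text \<open>In a chart, \<open>\<nabla>T = 0\<close> is the Lax equation for the components along an integral curve, so the composite
  with \<open>\<phi>\<close> has derivative zero. Changing the chart conjugates the components by the Jacobian, so \<open>\<phi>\<close> does
  not notice it.\<close>

lemma scalar_first_integral_similarity_invariant:
  fixes A :: "('m, real^'n::finite) chart set" and \<phi> :: "real^'n^'n \<Rightarrow> real"
  assumes M: "smooth_manifold X A" and T: "tensor_field_11 A T"
    and nabla: "\<And>c z i j. c \<in> A \<Longrightarrow> z \<in> slit_range c \<Longrightarrow> nabla_11 A S T c z $ i $ j = 0"
    and \<phi>: "\<And>M. \<phi> differentiable at M"
    and inv: "\<And>P M M'. invertible P \<Longrightarrow> M' ** P = P ** M \<Longrightarrow> \<phi> M' = \<phi> M"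
  shows "scalar_first_integral A S T \<phi>"
proof -
  define f where "f = (\<lambda>z. \<phi> (T (SOME c. c \<in> A \<and> fst z \<in> fst c)
      (snd (slit_chart A (SOME c. c \<in> A \<and> fst z \<in> fst c)) z)))"
  have f: "f z = \<phi> (T c (snd (slit_chart A c) z))" if c: "c \<in> A" and z: "z \<in> T0M A" "fst z \<in> fst c" for c z
  proof -
    define d where "d = (SOME d. d \<in> A \<and> fst z \<in> fst d)"
    have d: "d \<in> A" "fst z \<in> fst d"
      using someI_ex[of "\<lambda>d. d \<in> A \<and> fst z \<in> fst d"] c z unfolding d_def by blast+
    let ?J = "matrix (jac c d (fst z))" and ?K = "matrix (jac d c (fst z))"
    have "?J ** ?K = matrix (jac c d (fst z) \<circ> jac d c (fst z))"
      using c d z by (intro matrix_compose[symmetric] linear_jac[OF M])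
    also have "jac c d (fst z) \<circ> jac d c (fst z) = id"
      using c d z by (simp add: fun_eq_iff jac_comp[OF M] jac_self[OF M])
    finally have "?J ** ?K = mat 1" by (simp only: matrix_id_mat_1)
    then have "invertible ?J"
      unfolding invertible_right_inverse by blast
    moreover have "T d (snd (slit_chart A d) z) ** ?J = ?J ** T c (snd (slit_chart A c) z)"
      using T c d z unfolding tensor_field_11_def Let_def by blast
    ultimately show ?thesis unfolding f_def d_def[symmetric] by (rule inv)
  qed
  have "(f \<circ> \<gamma>) constant_on I" if \<gamma>: "integral_curve (slit_atlas A) S I \<gamma>" for I \<gamma>
  proof -
    have I: "convex I"
      using \<gamma> unfolding integral_curve_def by (simp add: is_interval_convex)
    have "((f \<circ> \<gamma>) has_real_derivative 0) (at t)" if t: "t \<in> I" for t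
    proof -
      obtain c where c: "c \<in> A" "\<gamma> t \<in> T0M A" "fst (\<gamma> t) \<in> fst c"
        and ev: "\<forall>\<^sub>F s in at t. \<gamma> s \<in> T0M A \<and> fst (\<gamma> s) \<in> fst c"
        and u': "((\<lambda>s. snd (slit_chart A c) (\<gamma> s)) has_vector_derivative snd (S (\<gamma> t)) (slit_chart A c)) (at t)"
        using integral_curve_slit_chart[OF \<gamma> t] .
      define z where "z = snd (slit_chart A c) (\<gamma> t)"
      define v where "v = snd (S (\<gamma> t)) (slit_chart A c)"
      have z: "z \<in> slit_range c" unfolding z_def by (rule slit_coords[OF M c(2,1,3)])
      have v: "v = vf_comp A S c z"
        unfolding v_def vf_comp_def z_def using loc_coords[OF M c(2,1,3), of S] by simp
      have Td: "T c differentiable at z"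
        using T c(1) z unfolding tensor_field_11_def by (blast intro: smooth_on_differentiable)
      let ?N = "nonlin_conn A S c z" and ?D = "frechet_derivative (T c) (at z)"
      have "?D v = T c z ** ?N - ?N ** T c z"
        using nabla[OF c(1) z]
        by (simp add: vec_eq_iff matrix_matrix_mult_def nabla_11_def Let_def vf_apply_def
            frechet_derivative_matrix_entry[OF Td] v algebra_simps)
      then have 0: "frechet_derivative \<phi> (at (T c z)) (?D v) = 0"
        using similarity_invariant_lax[OF \<phi>[unfolded frechet_derivative_works] inv] by simp
      define u where "u = (\<lambda>s. snd (slit_chart A c) (\<gamma> s))"
      have "(u has_derivative (\<lambda>h. h *\<^sub>R v)) (at t)"
        using u' by (simp add: has_vector_derivative_def u_def v_def)
      moreover have "(T c has_derivative ?D) (at (u t))"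
        using Td by (simp add: frechet_derivative_works u_def z_def)
      ultimately have "((\<lambda>s. T c (u s)) has_derivative (\<lambda>h. ?D (h *\<^sub>R v))) (at t)"
        by (rule has_derivative_compose[where f = u and g = "T c"])
      moreover have "(\<phi> has_derivative frechet_derivative \<phi> (at (T c z))) (at (T c (u t)))"
        using \<phi>[of "T c z"] by (simp add: frechet_derivative_works u_def z_def)
      ultimately have "((\<lambda>s. \<phi> (T c (u s))) has_derivative
          (\<lambda>h. frechet_derivative \<phi> (at (T c z)) (?D (h *\<^sub>R v)))) (at t)"
        by (rule has_derivative_compose[where f = "\<lambda>s. T c (u s)" and g = \<phi>])
      moreover have "frechet_derivative \<phi> (at (T c z)) (?D (h *\<^sub>R v)) = 0" for h
        using 0 linear_cmul[OF linear_frechet_derivative[OF Td]]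
          linear_cmul[OF linear_frechet_derivative[OF \<phi>]] by simp
      ultimately have "((\<lambda>s. \<phi> (T c (u s))) has_derivative (\<lambda>h. 0)) (at t)"
        by simp
      then have "((f \<circ> \<gamma>) has_derivative (\<lambda>h. 0)) (at t)"
        by (rule has_derivative_transform_eventually)
          (use ev c in \<open>auto simp: f u_def elim!: eventually_mono\<close>)
      moreover have "(*) 0 = (\<lambda>h::real. 0::real)" by auto
      ultimately show ?thesis by (simp add: has_field_derivative_def)
    qed
    then have "\<exists>k. \<forall>t\<in>I. (f \<circ> \<gamma>) t = k"
      by (intro has_field_derivative_zero_constant[OF I]) (rule has_field_derivative_at_within)
    then show ?thesis by (simp add: constant_on_def)
  qed
  then show ?thesis
    unfolding scalar_first_integral_def first_integral_def using f by blast
qed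

text \<open>This carries the result over from the coefficients of the characteristic polynomial to the set of its roots.\<close>

lemma scalar_first_integral_family:
  assumes "\<And>k. scalar_first_integral A S T (\<phi> k)"
  shows "scalar_first_integral A S T (\<lambda>M. g (\<lambda>k. \<phi> k M))"
proof -
  obtain f where f: "\<And>k c z. c \<in> A \<Longrightarrow> z \<in> T0M A \<Longrightarrow> fst z \<in> fst c \<Longrightarrow> f k z = \<phi> k (T c (snd (slit_chart A c) z))"
    and fi: "\<And>k. first_integral (slit_atlas A) S (f k)"
    using assms unfolding scalar_first_integral_def by metis
  have "first_integral (slit_atlas A) S (\<lambda>z. g (\<lambda>k. f k z))"
    unfolding first_integral_def
  proof (intro allI impI)
    fix I \<gamma> assume "integral_curve (slit_atlas A) S I \<gamma>"
    then have "\<forall>k. \<exists>y. \<forall>t\<in>I. f k (\<gamma> t) = y"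
      using fi unfolding first_integral_def constant_on_def by (simp add: o_def)
    then obtain y where "\<And>k t. t \<in> I \<Longrightarrow> f k (\<gamma> t) = y k" by metis
    then show "((\<lambda>z. g (\<lambda>k. f k z)) \<circ> \<gamma>) constant_on I" by (simp add: constant_on_def)
  qed
  then show ?thesis
    unfolding scalar_first_integral_def using f by (intro exI[of _ "\<lambda>z. g (\<lambda>k. f k z)"]) simp
qed

text \<open>Along an integral curve the set of eigenvalues is fixed and finite, so a continuous choice of an
  eigenvalue cannot jump.\<close>

lemma first_integral_eigenvalue_selection:
  fixes A :: "('m, real^'n::finite) chart set"
  assumes M: "smooth_manifold X A" and ev: "scalar_first_integral A S T eigenvalues"
    and cont: "continuous_fun (slit_atlas A) lam"
    and lam: "\<And>c z. c \<in> A \<Longrightarrow> z \<in> T0M A \<Longrightarrow> fst z \<in> fst c \<Longrightarrow>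
      lam z \<in> eigenvalues (T c (snd (slit_chart A c) z))"
  shows "first_integral (slit_atlas A) S lam"
  unfolding first_integral_def
proof (intro allI impI)
  fix I \<gamma> assume \<gamma>: "integral_curve (slit_atlas A) S I \<gamma>"
  obtain f where f: "\<And>c z. c \<in> A \<Longrightarrow> z \<in> T0M A \<Longrightarrow> fst z \<in> fst c \<Longrightarrow> f z = eigenvalues (T c (snd (slit_chart A c) z))"
    and "first_integral (slit_atlas A) S f"
    using ev unfolding scalar_first_integral_def by blast
  then have "(f \<circ> \<gamma>) constant_on I"
    using \<gamma> unfolding first_integral_def by blast
  then obtain E where E: "\<And>t. t \<in> I \<Longrightarrow> f (\<gamma> t) = E"
    by (auto simp: constant_on_def)
  have inE: "lam (\<gamma> t) \<in> E \<and> finite E" if t: "t \<in> I" for t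
  proof -
    obtain c where "c \<in> A" "\<gamma> t \<in> T0M A" "fst (\<gamma> t) \<in> fst c"
      using integral_curve_slit_chart[OF \<gamma> t] .
    then show ?thesis using f lam finite_eigenvalues E[OF t] by metis
  qed
  have "continuous_on I (lam \<circ> \<gamma>)"
  proof (intro continuous_at_imp_continuous_on ballI)
    fix t assume t: "t \<in> I"
    obtain c where c: "c \<in> A" "\<gamma> t \<in> T0M A" "fst (\<gamma> t) \<in> fst c"
      and ev: "\<forall>\<^sub>F s in at t. \<gamma> s \<in> T0M A \<and> fst (\<gamma> s) \<in> fst c"
      and u': "((\<lambda>s. snd (slit_chart A c) (\<gamma> s)) has_vector_derivative snd (S (\<gamma> t)) (slit_chart A c)) (at t)"
      using integral_curve_slit_chart[OF \<gamma> t] .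
    have "continuous_on (slit_range c) (loc A lam c)"
      using cont c(1) unfolding continuous_fun_def slit_atlas_def loc_def slit_chart_image[OF M c(1), symmetric]
      by blast
    then have "isCont (loc A lam c) (snd (slit_chart A c) (\<gamma> t))"
      using open_slit_range[OF M c(1)] slit_coords[OF M c(2,1,3)] by (simp add: continuous_on_eq_continuous_at)
    moreover have "((\<lambda>s. snd (slit_chart A c) (\<gamma> s)) \<longlongrightarrow> snd (slit_chart A c) (\<gamma> t)) (at t)"
      using has_vector_derivative_continuous[OF u'] by (simp add: isCont_def)
    ultimately have "((\<lambda>s. loc A lam c (snd (slit_chart A c) (\<gamma> s))) \<longlongrightarrow> loc A lam c (snd (slit_chart A c) (\<gamma> t))) (at t)"
      by (rule isCont_tendsto_compose)
    then have "((\<lambda>s. lam (\<gamma> s)) \<longlongrightarrow> lam (\<gamma> t)) (at t)"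
      unfolding loc_coords[OF M c(2,1,3)]
      by (rule Lim_transform_eventually) (use ev c in \<open>auto simp: loc_coords[OF M] elim!: eventually_mono\<close>)
    then show "isCont (lam \<circ> \<gamma>) t" by (simp add: isCont_def o_def)
  qed
  moreover have "finite ((lam \<circ> \<gamma>) ` I)"
  proof (cases "I = {}")
    case False
    then have "finite E" using inE by blast
    then show ?thesis using inE by (auto intro: finite_subset)
  qed simp
  moreover have "connected I"
    using \<gamma> unfolding integral_curve_def by (simp add: is_interval_connected)
  ultimately show "(lam \<circ> \<gamma>) constant_on I"
    by (intro continuous_finite_range_constant)
qed

section \<open>Metric tensors of Finsler structures\<close>

lemma metric_tensor_hess: "metric_tensor A F c z = (1/2) *\<^sub>R hess (\<lambda>w. (loc A F c w)\<^sup>2) z"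
  by (simp add: vec_eq_iff metric_tensor_def hess_def)

context
  fixes X :: "'m topology" and A :: "('m, real^'n::finite) chart set" and F :: "('m, real^'n) tangent \<Rightarrow> real"
    and c :: "('m, real^'n) chart"
  assumes M: "smooth_manifold X A" and F: "finsler A F" and c: "c \<in> A"
begin

lemma smooth_on_finsler: "smooth_on (slit_range c) (loc A F c)"
  using F c unfolding finsler_def smooth_fun_def slit_atlas_def loc_def slit_chart_image[OF M c, symmetric]
  by blast

lemma smooth_on_finsler_square: "smooth_on (slit_range c) (\<lambda>w. (loc A F c w)\<^sup>2)"
  unfolding power2_eq_square
  by (intro smooth_on_bilinear[OF bounded_bilinear_mult] smooth_on_finsler open_slit_range[OF M c])

lemma finsler_pos:
  assumes "z \<in> slit_range c"
  shows "loc A F c z > 0"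
proof -
  obtain w where w: "w \<in> T0M A" "fst w \<in> fst c" "snd (slit_chart A c) w = z"
    using slit_range_coords[OF M c assms] .
  then have "loc A F c z = F w" using loc_coords[OF M w(1) c w(2), of F] by simp
  then show ?thesis using F w(1) unfolding finsler_def by simp
qed

lemma finsler_homogeneous:
  "z \<in> slit_range c \<Longrightarrow> a > 0 \<Longrightarrow> loc A F c (fst z, a *\<^sub>R snd z) = a * loc A F c z"
  using F by (intro loc_homogeneous[OF M _ c]) (auto simp: finsler_def)

lemma smooth_on_metric: "smooth_on (slit_range c) (metric_tensor A F c)"
  unfolding metric_tensor_hess[abs_def]
  by (intro smooth_on_bounded_linear[OF bounded_linear_scaleR_right] smooth_on_hess
      smooth_on_finsler_square open_slit_range[OF M c])

lemma invertible_metric: "z \<in> slit_range c \<Longrightarrow> invertible (metric_tensor A F c z)"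
  using F c unfolding finsler_def by blast

lemma metric_entry:
  assumes "z \<in> slit_range c"
  shows "metric_tensor A F c z $ i $ j
    = dy i (loc A F c) z * dy j (loc A F c) z + loc A F c z * hess (loc A F c) z $ i $ j"
  using hess_square[OF open_slit_range[OF M c] smooth_on_finsler assms, of i j]
  by (simp add: metric_tensor_hess)

lemma angular_metric_hess:
  "z \<in> slit_range c \<Longrightarrow> angular_metric A F c z = loc A F c z *\<^sub>R hess (loc A F c) z"
  by (simp add: vec_eq_iff angular_metric_def metric_entry)

lemma metric_contraction:
  assumes z: "z \<in> slit_range c"
  shows "(\<Sum>l\<in>UNIV. metric_tensor A F c z $ k $ l * snd z $ l) = loc A F c z * dy k (loc A F c) z"
    and "(\<Sum>l\<in>UNIV. dy l (loc A F c) z * snd z $ l) = loc A F c z"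
proof -
  note W = open_slit_range[OF M c]
  have euler: "(\<Sum>l\<in>UNIV. dy l (loc A F c) z * snd z $ l) = loc A F c z"
    using euler_homogeneous[of "loc A F c" "fst z" "snd z" 1] finsler_homogeneous[OF z]
      smooth_on_differentiable[OF smooth_on_finsler z]
    by (simp add: frechet_derivative_coordinates[OF smooth_on_differentiable[OF smooth_on_finsler z]] mult.commute)
  have "hess (loc A F c) z $ k $ l = hess (loc A F c) z $ l $ k" for l
    by (simp add: hess_def dy_commute[OF W z smooth_on_finsler, of k l])
  then have "(\<Sum>l\<in>UNIV. hess (loc A F c) z $ k $ l * snd z $ l) = 0"
    using euler_hess[OF W smooth_on_finsler z, of 1 k] finsler_homogeneous by simp
  moreover have "(\<Sum>l\<in>UNIV. metric_tensor A F c z $ k $ l * snd z $ l)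
     = dy k (loc A F c) z * (\<Sum>l\<in>UNIV. dy l (loc A F c) z * snd z $ l)
       + loc A F c z * (\<Sum>l\<in>UNIV. hess (loc A F c) z $ k $ l * snd z $ l)"
    by (simp add: metric_entry[OF z] sum_distrib_left sum.distrib[symmetric] algebra_simps)
  ultimately show "(\<Sum>l\<in>UNIV. metric_tensor A F c z $ k $ l * snd z $ l) = loc A F c z * dy k (loc A F c) z"
    by (simp add: euler)
  show "(\<Sum>l\<in>UNIV. dy l (loc A F c) z * snd z $ l) = loc A F c z" by (rule euler)
qed

text \<open>By Euler's identities \<open>g\<^sub>l\<^sub>s y\<^sup>l y\<^sup>s = F\<^sup>2\<close> and \<open>g\<^sub>k\<^sub>l y\<^sup>l = F \<partial>F/\<partial>y\<^sup>k\<close>; this is the source of the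
  second expression for the tensor.\<close>

lemma angular_metric_contraction:
  assumes z: "z \<in> slit_range c"
  shows "(\<Sum>l\<in>UNIV. \<Sum>s\<in>UNIV. (metric_tensor A F c z $ k $ j * metric_tensor A F c z $ l $ s
      - metric_tensor A F c z $ k $ l * metric_tensor A F c z $ j $ s) * snd z $ l * snd z $ s)
    = (loc A F c z)\<^sup>2 * angular_metric A F c z $ k $ j"
proof -
  let ?g = "metric_tensor A F c z" and ?y = "snd z" and ?F = "loc A F c z"
  have "(\<Sum>l\<in>UNIV. \<Sum>s\<in>UNIV. (?g $ k $ j * ?g $ l $ s - ?g $ k $ l * ?g $ j $ s) * ?y $ l * ?y $ s)
     = ?g $ k $ j * (\<Sum>l\<in>UNIV. (\<Sum>s\<in>UNIV. ?g $ l $ s * ?y $ s) * ?y $ l)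
       - (\<Sum>l\<in>UNIV. ?g $ k $ l * ?y $ l) * (\<Sum>s\<in>UNIV. ?g $ j $ s * ?y $ s)"
    by (simp add: sum_product sum_distrib_left sum_distrib_right sum_subtractf[symmetric] algebra_simps)
  also have "(\<Sum>l\<in>UNIV. (\<Sum>s\<in>UNIV. ?g $ l $ s * ?y $ s) * ?y $ l) = ?F * ?F"
    using metric_contraction(2)[OF z] by (simp add: metric_contraction(1)[OF z] mult.assoc flip: sum_distrib_left)
  also have "?g $ k $ j * (?F * ?F) - (\<Sum>l\<in>UNIV. ?g $ k $ l * ?y $ l) * (\<Sum>s\<in>UNIV. ?g $ j $ s * ?y $ s)
      = ?F\<^sup>2 * angular_metric A F c z $ k $ j"
    unfolding metric_contraction(1)[OF z] by (simp add: angular_metric_def power2_eq_square algebra_simps)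
  finally show ?thesis .
qed

end

section \<open>The invariant tensor\<close>

context
  fixes X :: "'m topology" and A :: "('m, real^'n::finite) chart set" and F Ft :: "('m, real^'n) tangent \<Rightarrow> real"
  assumes M: "smooth_manifold X A" and F: "finsler A F" and Ft: "finsler A Ft"
begin

text \<open>The angular metric is \<open>Ft\<close> times the Hessian, so the denominator \<open>Ft\<close> cancels.\<close>

lemma H_tensor_hess:
  assumes "c \<in> A" "z \<in> slit_range c"
  shows "H_tensor A F Ft c z = loc A F c z *\<^sub>R (matrix_inv (metric_tensor A F c z) ** hess (loc A Ft c) z)"
proof -
  have "loc A Ft c z \<noteq> 0" using finsler_pos[OF M Ft assms] by simp
  then show ?thesis
    by (simp add: vec_eq_iff H_tensor_def angular_metric_hess[OF M Ft assms] matrix_matrix_mult_def sum_distrib_left)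
qed

lemma smooth_on_H_tensor:
  assumes c: "c \<in> A"
  shows "smooth_on (slit_range c) (H_tensor A F Ft c)"
proof (rule smooth_on_cong)
  show W: "open (slit_range c)" by (rule open_slit_range[OF M c])
  show "smooth_on (slit_range c)
      (\<lambda>z. loc A F c z *\<^sub>R (matrix_inv (metric_tensor A F c z) ** hess (loc A Ft c) z))"
    by (intro smooth_on_bilinear[OF bounded_bilinear_scaleR W] smooth_on_bilinear[OF bounded_bilinear_matrix_mult W]
        smooth_on_matrix_inv[OF W] smooth_on_hess[OF W] smooth_on_metric[OF M F c]
        smooth_on_finsler[OF M F c] smooth_on_finsler[OF M Ft c] invertible_metric[OF M F c])
qed (simp add: H_tensor_hess[OF c])

lemma hess_loc_change:
  fixes f :: "('m, real^'n) tangent \<Rightarrow> real"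
  assumes cd: "c \<in> A" "d \<in> A" "p \<in> fst c" "p \<in> fst d" "y \<noteq> 0"
    and f: "smooth_on (slit_range c) (loc A f c)" "smooth_on (slit_range d) (loc A f d)"
  shows "hess (loc A f c) (snd c p, y)
    = transpose (matrix (jac c d p)) ** hess (loc A f d) (snd d p, jac c d p y) ** matrix (jac c d p)"
  using cd f unfolding slit_range_def
  by (intro hess_linear_change[of _ _ _ _ _ _ "snd c ` fst c" "snd d ` fst d"])
    (auto simp: loc_change[OF M cd(1-4)] linear_jac[OF M] jac_nonzero[OF M cd(1-4)])

text \<open>Both \<open>g\<close> and \<open>B\<close> transform as \<open>J\<^sup>T (_) J\<close>, so the inverse of \<open>g\<close> transforms contragrediently and
  the transposed Jacobian in between cancels.\<close>

lemma tensor_field_H: "tensor_field_11 A (H_tensor A F Ft)"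
  unfolding tensor_field_11_def Let_def
proof (intro conjI ballI impI)
  fix c d z assume c: "c \<in> A" and d: "d \<in> A" and z: "z \<in> T0M A" "fst z \<in> fst c \<inter> fst d"
  define p y where "p = fst z" and "y = snd z c"
  have p: "p \<in> fst c" "p \<in> fst d" using z by (auto simp: p_def)
  have y: "y \<noteq> 0" using T0M_nonzero[OF M z(1) c] z(2) by (simp add: y_def)
  define J where "J = matrix (jac c d p)"
  have zc: "snd (slit_chart A c) z = (snd c p, y)" by (simp add: slit_chart_def p_def y_def)
  have "snd z d = jac c d p y"
    using snd_tvec[OF M d p(2), of c y] TM_eq_tvec[OF M _ c, of z] z
    by (simp add: T0M_def p_def y_def)
  then have zd: "snd (slit_chart A d) z = (snd d p, jac c d p y)" by (simp add: slit_chart_def p_def)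
  have inc: "(snd c p, y) \<in> slit_range c" using p y by (simp add: slit_range_def)
  have ind: "(snd d p, jac c d p y) \<in> slit_range d"
    using p jac_nonzero[OF M c d p y] by (simp add: slit_range_def)
  let ?gc = "metric_tensor A F c (snd c p, y)" and ?gd = "metric_tensor A F d (snd d p, jac c d p y)"
  let ?Bc = "hess (loc A Ft c) (snd c p, y)" and ?Bd = "hess (loc A Ft d) (snd d p, jac c d p y)"
  note bb = bounded_bilinear_matrix_mult
  have B: "?Bc = transpose J ** ?Bd ** J"
    unfolding J_def by (rule hess_loc_change[OF c d p y smooth_on_finsler[OF M Ft c] smooth_on_finsler[OF M Ft d]])
  have sq: "(\<lambda>w. (loc A F e w)\<^sup>2) = loc A (\<lambda>z. (F z)\<^sup>2) e" for e
    by (simp add: loc_def o_def)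
  have "?gc = transpose J ** ?gd ** J"
    using hess_loc_change[OF c d p y, of "\<lambda>z. (F z)\<^sup>2"] smooth_on_finsler_square[OF M F c] smooth_on_finsler_square[OF M F d]
    by (simp add: metric_tensor_hess sq J_def bounded_bilinear.scaleR_left[OF bb] bounded_bilinear.scaleR_right[OF bb])
  then have "transpose J ** (?gd ** J ** matrix_inv ?gc) = mat 1"
    using matrix_inv_inverse(1)[OF invertible_metric[OF M F c inc]] by (simp add: matrix_mul_assoc)
  then have "(?gd ** J ** matrix_inv ?gc) ** transpose J = mat 1"
    by (simp add: matrix_left_right_inverse)
  then have gi: "matrix_inv ?gd = J ** matrix_inv ?gc ** transpose J"
    by (intro matrix_inv_unique) (simp add: matrix_mul_assoc)
  have "loc A F c (snd c p, y) = loc A F d (snd d p, jac c d p y)"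
    by (rule loc_change[OF M c d p y])
  then show "H_tensor A F Ft d (snd (slit_chart A d) z) ** matrix (jac c d (fst z))
      = matrix (jac c d (fst z)) ** H_tensor A F Ft c (snd (slit_chart A c) z)"
    unfolding zc zd H_tensor_hess[OF c inc] H_tensor_hess[OF d ind] gi B p_def[symmetric] J_def[symmetric]
    by (simp add: bounded_bilinear.scaleR_left[OF bb] bounded_bilinear.scaleR_right[OF bb] matrix_mul_assoc)
qed (rule smooth_on_H_tensor)

lemma H_tensor_formula:
  assumes c: "c \<in> A" and z: "z \<in> slit_range c"
  shows "H_tensor A F Ft c z $ i $ j = loc A F c z / (loc A Ft c z) ^ 3 *
    (\<Sum>k\<in>UNIV. \<Sum>l\<in>UNIV. \<Sum>s\<in>UNIV. matrix_inv (metric_tensor A F c z) $ i $ k *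
      (metric_tensor A Ft c z $ k $ j * metric_tensor A Ft c z $ l $ s
        - metric_tensor A Ft c z $ k $ l * metric_tensor A Ft c z $ j $ s) * snd z $ l * snd z $ s)"
proof -
  let ?gi = "matrix_inv (metric_tensor A F c z)" and ?g = "metric_tensor A Ft c z" and ?y = "snd z"
  have "(\<Sum>k\<in>UNIV. \<Sum>l\<in>UNIV. \<Sum>s\<in>UNIV. ?gi $ i $ k * (?g $ k $ j * ?g $ l $ s - ?g $ k $ l * ?g $ j $ s) * ?y $ l * ?y $ s)
     = (\<Sum>k\<in>UNIV. ?gi $ i $ k * (\<Sum>l\<in>UNIV. \<Sum>s\<in>UNIV. (?g $ k $ j * ?g $ l $ s - ?g $ k $ l * ?g $ j $ s) * ?y $ l * ?y $ s))"
    by (simp add: sum_distrib_left mult.assoc)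
  also have "\<dots> = (loc A Ft c z)\<^sup>2 * (\<Sum>k\<in>UNIV. ?gi $ i $ k * angular_metric A Ft c z $ k $ j)"
    unfolding angular_metric_contraction[OF M Ft c z] by (simp add: sum_distrib_left mult_ac)
  finally have "(\<Sum>k\<in>UNIV. \<Sum>l\<in>UNIV. \<Sum>s\<in>UNIV. ?gi $ i $ k * (?g $ k $ j * ?g $ l $ s - ?g $ k $ l * ?g $ j $ s) * ?y $ l * ?y $ s)
     = (loc A Ft c z)\<^sup>2 * (\<Sum>k\<in>UNIV. ?gi $ i $ k * angular_metric A Ft c z $ k $ j)" .
  note sum = this
  show ?thesis
    unfolding sum using finsler_pos[OF M Ft c z]
    by (simp add: H_tensor_def power2_eq_square power3_eq_cube)
qed

text \<open>The three factors of \<open>F g\<^sup>-\<^sup>1 B\<close> are transported by \<open>S\<close>: \<open>F\<close> is conserved, and the Hessians of \<open>F\<^sup>2\<close>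
  and \<open>Ft\<close> both obey \<open>hess_lie_derivative\<close>. The product rule then gives the commutator of \<open>H\<close> and \<open>N\<close>.\<close>

lemma nabla_H_zero:
  assumes S: "geodesic_spray A F S" and gyro: "gyroscopic A S Ft" and c: "c \<in> A" and z: "z \<in> slit_range c"
  shows "nabla_11 A S (H_tensor A F Ft) c z $ i $ j = 0"
proof -
  note bb = bounded_bilinear_matrix_mult
  define W where "W = slit_range c"
  define V where "V = vf_comp A S c"
  define L Lt where "L = loc A F c" and "Lt = loc A Ft c"
  have W: "open W" "z \<in> W" unfolding W_def using open_slit_range[OF M c] z by auto
  have L: "smooth_on W L" "smooth_on W (\<lambda>w. (L w)\<^sup>2)" and Lt: "smooth_on W Lt"
    unfolding W_def L_def Lt_def
    using smooth_on_finsler[OF M F c] smooth_on_finsler_square[OF M F c] smooth_on_finsler[OF M Ft c] by auto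
  obtain G where G: "smooth_on W G" and VG: "\<And>w. w \<in> W \<Longrightarrow> V w = (snd w, - 2 *\<^sub>R G w)"
    using S c unfolding geodesic_spray_def spray_def W_def V_def by fastforce
  have Gd: "G differentiable at w" if "w \<in> W" for w by (rule smooth_on_differentiable[OF G that])
  define N where "N = (\<chi> i j. dy j (\<lambda>w. G w $ i) z)"
  have N: "nonlin_conn A S c z = N"
    unfolding nonlin_conn_def N_def
    by (simp add: vec_eq_iff) (intro allI dy_cong[OF W], simp add: spray_coeff_def VG[unfolded V_def])
  have EL_F: "frechet_derivative (dy i (\<lambda>w. (L w)\<^sup>2)) (at w) (V w) - dx i (\<lambda>w. (L w)\<^sup>2) w = 0" if "w \<in> W" for w i
    using S c that unfolding geodesic_spray_def vf_apply_def L_def V_def W_def by blast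
  have hess_F: "frechet_derivative (hess (\<lambda>w. (L w)\<^sup>2)) (at z) (V z)
      = hess (\<lambda>w. (L w)\<^sup>2) z ** N + transpose N ** hess (\<lambda>w. (L w)\<^sup>2) z"
    unfolding N_def
    by (rule hess_lie_derivative[OF W(1) L(2) Gd VG _ _ _ W(2), where \<omega> = "\<lambda>_ _ _. 0"]) (simp_all add: EL_F)
  obtain \<omega> where \<omega>: "two_form A \<omega>" and EL_Ft: "\<And>w i. w \<in> W \<Longrightarrow>
      frechet_derivative (dy i Lt) (at w) (V w) - dx i Lt w = (\<Sum>j\<in>UNIV. form_comp A \<omega> c i j (fst w) * snd w $ j)"
    using gyro c unfolding gyroscopic_def vf_apply_def Lt_def V_def W_def by fastforce
  have \<omega>d: "form_comp A \<omega> c i j differentiable at (fst w)" if "w \<in> W" for w i j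
    using \<omega> c that unfolding two_form_def W_def slit_range_def
    by (auto intro: smooth_on_differentiable[of "snd c ` fst c"])
  have skew: "form_comp A \<omega> c i j (fst w) = - form_comp A \<omega> c j i (fst w)" if "w \<in> W" for w i j
  proof -
    have "chart_inv c (fst w) \<in> fst c"
      using that chart_inv_chart[OF M c] unfolding W_def slit_range_def by auto
    then show ?thesis using \<omega> c unfolding two_form_def form_comp_def by blast
  qed
  have hess_Ft: "frechet_derivative (hess Lt) (at z) (V z) = hess Lt z ** N + transpose N ** hess Lt z"
    unfolding N_def
    by (rule hess_lie_derivative[OF W(1) Lt Gd VG EL_Ft \<omega>d skew W(2)])
  have F0: "frechet_derivative L (at z) (V z) = 0"
  proof -
    have "frechet_derivative (\<lambda>w. (L w)\<^sup>2) (at z) (V z) = 0"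
    proof (rule energy_conserved[where V = V, OF W(1) L(2) W(2) _ VG[OF W(2)]])
      show "(L (fst w, a *\<^sub>R snd w))\<^sup>2 = a\<^sup>2 * (L w)\<^sup>2" if "w \<in> W" "a > 0" for w a
        using finsler_homogeneous[OF M F c, of w a] that by (simp add: L_def W_def power_mult_distrib)
    qed (use EL_F[OF W(2)] in simp)
    moreover have "((\<lambda>w. (L w)\<^sup>2) has_derivative (\<lambda>v. 2 * L z * frechet_derivative L (at z) v)) (at z)"
      using smooth_on_differentiable[OF L(1) W(2)]
      by (auto intro!: derivative_eq_intros simp: frechet_derivative_works)
    ultimately have "2 * L z * frechet_derivative L (at z) (V z) = 0"
      using frechet_derivative_at by metis
    moreover have "L z > 0" using finsler_pos[OF M F c z] by (simp add: L_def)
    ultimately show ?thesis by simp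
  qed
  let ?g = "metric_tensor A F c"
  let ?gi = "matrix_inv (?g z)" and ?B = "hess Lt z" and ?H = "H_tensor A F Ft c z"
  have g': "(?g has_derivative (\<lambda>v. (1/2) *\<^sub>R frechet_derivative (hess (\<lambda>w. (L w)\<^sup>2)) (at z) v)) (at z)"
    unfolding metric_tensor_hess[abs_def] L_def[symmetric]
    using smooth_on_differentiable[OF smooth_on_hess[OF W(1) L(2)] W(2)]
    by (intro has_derivative_scaleR_right) (simp add: frechet_derivative_works)
  have g'V: "(1/2) *\<^sub>R frechet_derivative (hess (\<lambda>w. (L w)\<^sup>2)) (at z) (V z) = ?g z ** N + transpose N ** ?g z"
    by (simp add: hess_F metric_tensor_hess L_def[symmetric] scaleR_add_right
        bounded_bilinear.scaleR_left[OF bb] bounded_bilinear.scaleR_right[OF bb])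
  have inv: "invertible (?g z)" by (rule invertible_metric[OF M F c z])
  have B': "(hess Lt has_derivative frechet_derivative (hess Lt) (at z)) (at z)"
    using smooth_on_differentiable[OF smooth_on_hess[OF W(1) Lt] W(2)] by (simp add: frechet_derivative_works)
  have L': "(L has_derivative frechet_derivative L (at z)) (at z)"
    using smooth_on_differentiable[OF L(1) W(2)] by (simp add: frechet_derivative_works)
  have "((\<lambda>w. L w *\<^sub>R (matrix_inv (?g w) ** hess Lt w)) has_derivative
    (\<lambda>v. L z *\<^sub>R (?gi ** frechet_derivative (hess Lt) (at z) v
         + (- (?gi ** ((1/2) *\<^sub>R frechet_derivative (hess (\<lambda>w. (L w)\<^sup>2)) (at z) v) ** ?gi)) ** ?B)
       + frechet_derivative L (at z) v *\<^sub>R (?gi ** ?B))) (at z)"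
    by (rule bounded_bilinear.FDERIV[OF bounded_bilinear_scaleR L'
          bounded_bilinear.FDERIV[OF bb has_derivative_matrix_inv[OF g' inv] B']])
  then have H': "(H_tensor A F Ft c has_derivative
    (\<lambda>v. L z *\<^sub>R (?gi ** frechet_derivative (hess Lt) (at z) v
         + (- (?gi ** ((1/2) *\<^sub>R frechet_derivative (hess (\<lambda>w. (L w)\<^sup>2)) (at z) v) ** ?gi)) ** ?B)
       + frechet_derivative L (at z) v *\<^sub>R (?gi ** ?B))) (at z)"
    by (rule has_derivative_transform_within_open[OF _ W])
      (simp add: H_tensor_hess[OF c] W_def L_def Lt_def)
  have "frechet_derivative (H_tensor A F Ft c) (at z) (V z)
      = L z *\<^sub>R (?gi ** (?B ** N + transpose N ** ?B)
         + (- (?gi ** (?g z ** N + transpose N ** ?g z) ** ?gi)) ** ?B)"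
    unfolding frechet_derivative_at[OF H', symmetric] by (simp only: F0 g'V hess_Ft) simp
  also have "\<dots> = L z *\<^sub>R (?gi ** ?B ** N - N ** (?gi ** ?B))"
    using lax_algebra[OF matrix_inv_inverse(2,1)[OF inv], of N "transpose N" ?B] by (simp add: add.commute)
  also have "\<dots> = ?H ** N - N ** ?H"
    by (simp add: H_tensor_hess[OF c z] L_def[symmetric] Lt_def[symmetric] scaleR_diff_right
        bounded_bilinear.scaleR_left[OF bb] bounded_bilinear.scaleR_right[OF bb])
  finally have lax: "frechet_derivative (H_tensor A F Ft c) (at z) (V z) = ?H ** N - N ** ?H" .
  have "vf_apply A S c (\<lambda>w. H_tensor A F Ft c w $ i $ j) z = (?H ** N - N ** ?H) $ i $ j"
    unfolding vf_apply_def V_def[symmetric] lax[symmetric]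
    using H' by (intro frechet_derivative_matrix_entry) (auto simp: differentiable_def)
  then show ?thesis
    by (simp add: nabla_11_def Let_def N matrix_matrix_mult_def mult.commute)
qed

end

theorem mainTheorem4:
  fixes X :: "'m topology"
    and A :: "('m, real^'n::finite) chart set"
    and F Ft :: "('m, real^'n) tangent \<Rightarrow> real"
    and S :: "('m, real^'n) tangent \<Rightarrow> (('m, real^'n) tangent, (real^'n) \<times> (real^'n)) tangent"
  assumes "smooth_manifold X A" and "connected_space X"
    and "finsler A F" and "finsler A Ft"
    and "geodesic_spray A F S"
    and "gyroscopic A S Ft"
  shows "tensor_field_11 A (H_tensor A F Ft)
    \<and> (\<forall>c\<in>A. \<forall>(x, y)\<in>slit_range c. \<forall>i j.
         H_tensor A F Ft c (x, y) $ i $ j =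
           (let z = (x, y); ginv = matrix_inv (metric_tensor A F c z); gt = metric_tensor A Ft c z in
            loc A F c z / (loc A Ft c z) ^ 3 *
              (\<Sum>k\<in>UNIV. \<Sum>l\<in>UNIV. \<Sum>s\<in>UNIV.
                 ginv $ i $ k * (gt $ k $ j * gt $ l $ s - gt $ k $ l * gt $ j $ s) * y $ l * y $ s)))
    \<and> (\<forall>c\<in>A. \<forall>z\<in>slit_range c. \<forall>i j. nabla_11 A S (H_tensor A F Ft) c z $ i $ j = 0)
    \<and> (\<forall>k. scalar_first_integral A S (H_tensor A F Ft) (\<lambda>M. trace (matpow M k)))
    \<and> (\<forall>k. scalar_first_integral A S (H_tensor A F Ft) (\<lambda>M. coeff (charpoly M) k))
    \<and> scalar_first_integral A S (H_tensor A F Ft) eigenvalues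
    \<and> (\<forall>lam. continuous_fun (slit_atlas A) lam \<and>
         (\<forall>c\<in>A. \<forall>z\<in>T0M A. fst z \<in> fst c \<longrightarrow>
            lam z \<in> eigenvalues (H_tensor A F Ft c (snd (slit_chart A c) z)))
         \<longrightarrow> first_integral (slit_atlas A) S lam)"
proof -
  let ?H = "H_tensor A F Ft"
  note M = assms(1) and FF = assms(3,4)
  have T: "tensor_field_11 A ?H" by (rule tensor_field_H[OF M FF])
  have nabla: "nabla_11 A S ?H c z $ i $ j = 0" if "c \<in> A" "z \<in> slit_range c" for c z i j
    by (rule nabla_H_zero[OF M FF assms(5,6) that])
  note invariant = scalar_first_integral_similarity_invariant[OF M T nabla]
  have tr: "scalar_first_integral A S ?H (\<lambda>M. trace (matpow M k))" for k
    by (intro invariant differentiable_trace_matpow trace_matpow_similar)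
  have cp: "scalar_first_integral A S ?H (\<lambda>M. coeff (charpoly M) k)" for k
    by (intro invariant differentiable_coeff_charpoly
        arg_cong[where f = "\<lambda>p. coeff p k"] charpoly_similar)
  \<comment> \<open>the polynomial is rebuilt from its coefficients, each of which is a first integral\<close>
  have "scalar_first_integral A S ?H (\<lambda>M. {r. poly (map_poly complex_of_real (Abs_poly (coeff (charpoly M)))) r = 0})"
    by (rule scalar_first_integral_family[OF cp])
  then have ev: "scalar_first_integral A S ?H eigenvalues"
    by (simp add: coeff_inverse eigenvalues_charpoly[abs_def])
  show ?thesis
    using T H_tensor_formula[OF M FF] nabla tr cp ev first_integral_eigenvalue_selection[OF M ev]
    by (auto simp: Let_def)
qed

end
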